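(* Let $p$ be an odd prime. There exists an algebraic relation between $\lambda(\tau)$ and $\lambda(p\tau)$; that is, there is a nonzero polynomial $P\in\mathbb{C}[X,Y]$ such that $P(\lambda(\tau),\lambda(p\tau))=0$ for all $\tau\in\mathbb{C}$ with $\mathrm{Im}\,\tau>0$.
   Context: For $\tau\in\mathbb{C}$ with $\mathrm{Im}\,\tau>0$ and $\varepsilon,\varepsilon'\in\mathbb{R}$, $$\Theta\left[\begin{array}{c}\varepsilon\\ \varepsilon'\end{array}\right](0,\tau)=\sum_{m\in\mathbb{Z}}\exp\left(2\pi i\left\{\tfrac12\left(m+\tfrac{\varepsilon}{2}\right)^2\tau+\left(m+\tfrac{\varepsilon}{2}\right)\tfrac{\varepsilon'}{2}\right\}\right).$$ The function $\lambda$ is $$\lambda(\tau)=\frac{\Theta^4\left[\begin{array}{c}1\\0\end{array}\right](0,\tau)}{\Theta^4\left[\begin{array}{c}0\\0\end{array}\right](0,\tau)},$$ the invariant of the elliptic curve with period $\tau$ in Legendre form $y^2=x(x-1)(x-\lambda)$. *)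

theory Defs
  imports
    "HOL-Analysis.Analysis"
    "HOL-Computational_Algebra.Primes"
    "HOL-Computational_Algebra.Polynomial"
begin

(* The theta constant with characteristic [eps, eps'], i.e. the theta function at z = 0.
   For Im tau > 0 the series over the integers converges absolutely, so the unordered sum
   is its value; for other tau the definition is not meaningful. *)
definition theta_const :: "real \<Rightarrow> real \<Rightarrow> complex \<Rightarrow> complex" where
  "theta_const \<epsilon> \<epsilon>' \<tau> =
     (\<Sum>\<^sub>\<infinity>m\<in>(UNIV :: int set).
        exp (2 * of_real pi * \<i> *
             (1 / 2 * (of_int m + of_real \<epsilon> / 2)\<^sup>2 * \<tau>
              + (of_int m + of_real \<epsilon> / 2) * (of_real \<epsilon>' / 2))))"

definition modular_lambda :: "complex \<Rightarrow> complex" where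
  "modular_lambda \<tau> = theta_const 1 0 \<tau> ^ 4 / theta_const 0 0 \<tau> ^ 4"

(* C[X,Y] is represented as C[X][Y]: the coefficients of P are polynomials in X and
   the outer variable is Y. *)
definition poly2 :: "complex poly poly \<Rightarrow> complex \<Rightarrow> complex \<Rightarrow> complex" where
  "poly2 P x y = poly (poly P [:y:]) x"

end

theory Submission
  imports Defs "HOL-Complex_Analysis.Complex_Analysis" "HOL-Number_Theory.Cong"
begin

text \<open>
  The relation is deduced from the classical modular equation for an invariant of the full modular
  group.

  The theta constants transform simply under \<open>\<tau> \<mapsto> \<tau> + 1\<close> and \<open>\<tau> \<mapsto> -1/\<tau>\<close>. For the inversion this
  follows from the fact that the theta function is determined up to a constant factor by its
  behaviour under the two periods 1 and \<open>\<tau>\<close> (\<open>jtheta_inversion\<close>). The common factor cancels in the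
  quotient, and together with Jacobi's identity (\<open>jacobi_identity\<close>) one gets
  \<open>\<lambda>(\<tau> + 1) = \<lambda> / (\<lambda> - 1)\<close> and \<open>\<lambda>(-1/\<tau>) = 1 - \<lambda>\<close>. Hence
  \<open>J = (\<lambda>\<^sup>2 - \<lambda> + 1)\<^sup>3 / (\<lambda>\<^sup>2 (1 - \<lambda>)\<^sup>2)\<close> is invariant under the modular group. It is holomorphic because
  the theta constants have no zeros in the half-plane, and it has a simple pole at the cusp.

  The main principle is that a holomorphic invariant function that tends to 0 at the cusp vanishes
  (\<open>invariant_vanishing\<close>), which is an application of the maximum modulus principle. It yields Jacobi's
  identity and also shows that every holomorphic invariant function with at most a pole at the cusp is
  a polynomial in \<open>J\<close> (\<open>invariant_imp_poly_jinv\<close>).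

  For a prime \<open>p\<close> the modular group permutes the \<open>p + 1\<close> functions \<open>J(p \<tau>)\<close> and \<open>J((\<tau> + i) / p)\<close> with
  \<open>0 \<le> i < p\<close>. Therefore the coefficients of the monic polynomial with these roots are polynomials in
  \<open>J(\<tau>)\<close> (\<open>modular_poly_coeffs\<close>), and \<open>J(p \<tau>)\<close> satisfies an algebraic equation over them. As \<open>J\<close> is a
  rational function of \<open>\<lambda>\<close>, clearing denominators gives a relation between \<open>\<lambda>(\<tau>)\<close> and \<open>\<lambda>(p \<tau>)\<close>.
\<close>

section \<open>Periodic functions and Laurent expansions\<close>

text \<open>
  The variable \<open>q = exp (2 \<pi> i z)\<close>; it identifies the quotient of the complex plane by integer
  translations with the punctured plane.
\<close>

definition qexp :: "complex \<Rightarrow> complex" where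
  "qexp z = exp (2 * of_real pi * \<i> * z)"

lemma qexp_nonzero [simp]: "qexp z \<noteq> 0"
  by (simp add: qexp_def)

lemma qexp_add: "qexp (a + b) = qexp a * qexp b"
  by (simp add: qexp_def exp_add ring_distribs)

lemma qexp_of_int [simp]: "qexp (of_int n) = 1"
  by (simp add: qexp_def exp_eq_1 mult_ac)

lemma qexp_1 [simp]: "qexp 1 = 1" and qexp_0 [simp]: "qexp 0 = 1"
  using qexp_of_int[of 1] qexp_of_int[of 0] by simp_all

lemma norm_qexp: "norm (qexp z) = exp (- (2 * pi * Im z))"
  by (simp add: qexp_def)

lemma qexp_holomorphic [holomorphic_intros]:
  "f holomorphic_on S \<Longrightarrow> (\<lambda>z. qexp (f z)) holomorphic_on S"
  unfolding qexp_def by (intro holomorphic_intros)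

lemma qexp_eq_iff: "qexp a = qexp b \<longleftrightarrow> (\<exists>n::int. a = b + of_int n)"
proof -
  have "qexp a = qexp b \<longleftrightarrow>
      (\<exists>n::int. 2 * of_real pi * \<i> * a = 2 * of_real pi * \<i> * b + of_int (2 * n) * of_real pi * \<i>)"
    unfolding qexp_def by (subst exp_eq) (simp add: mult_ac)
  also have "\<dots> \<longleftrightarrow> (\<exists>n::int. 2 * of_real pi * \<i> * a = 2 * of_real pi * \<i> * (b + of_int n))"
    by (simp add: algebra_simps)
  finally show ?thesis by simp
qed

lemma qexp_Ln: "w \<noteq> 0 \<Longrightarrow> qexp (Ln w / (2 * of_real pi * \<i>)) = w"
  by (simp add: qexp_def)

text \<open>
  The codomain is arbitrary so that the same induction also moves predicates along integer
  translations.
\<close>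

lemma periodic_of_int:
  fixes f :: "complex \<Rightarrow> 'a"
  assumes U: "\<And>z. z + 1 \<in> U \<longleftrightarrow> z \<in> U" and f: "\<And>z. z \<in> U \<Longrightarrow> f (z + 1) = f z"
    and "z \<in> U"
  shows "z + of_int n \<in> U \<and> f (z + of_int n) = f z"
proof (induction n rule: int_induct[where k=0])
  case base
  then show ?case using assms by simp
next
  case (step1 i)
  then show ?case using f[of "z + of_int i"] U[of "z + of_int i"] by (simp add: add_ac)
next
  case (step2 i)
  have eq: "z + of_int (i - 1) + 1 = z + of_int i" by simp
  then show ?case using f[of "z + of_int (i - 1)"] U[of "z + of_int (i - 1)"] step2 unfolding eq
    by simp
qed

text \<open>
  A periodic function is the same thing as a function of \<open>q\<close>. Holomorphy in \<open>q\<close> is a local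
  question, and near every point there is a holomorphic branch of the logarithm through which the
  new function is expressed.
\<close>

lemma periodic_factor:
  assumes "open U" and holo: "f holomorphic_on U"
    and U: "\<And>z. z + 1 \<in> U \<longleftrightarrow> z \<in> U" and f: "\<And>z. z \<in> U \<Longrightarrow> f (z + 1) = f z"
  obtains g where "g holomorphic_on qexp ` U" and "\<And>z. z \<in> U \<Longrightarrow> g (qexp z) = f z"
proof -
  define g where "g w = f (SOME z. z \<in> U \<and> qexp z = w)" for w
  have g: "g (qexp z) = f z" if "z \<in> U" for z
  proof -
    define z' where "z' = (SOME z'. z' \<in> U \<and> qexp z' = qexp z)"
    have "z' \<in> U \<and> qexp z' = qexp z"
      unfolding z'_def by (rule someI[of _ z]) (use that in auto)
    then obtain n where "z' = z + of_int n" by (auto simp: qexp_eq_iff)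
    then show ?thesis
      using periodic_of_int[of U f z n, OF U f that] by (simp add: g_def z'_def)
  qed
  have "g field_differentiable (at w0 within qexp ` U)" if mem: "w0 \<in> qexp ` U" for w0
  proof -
    obtain z0 where z0: "z0 \<in> U" "w0 = qexp z0" using mem by (rule imageE)
    then have w0: "w0 \<noteq> 0" by simp
    \<comment> \<open>a branch of the logarithm near \<open>w0\<close> that takes \<open>w0\<close> to \<open>z0\<close>\<close>
    define l where "l w = z0 + Ln (w / w0) / (2 * of_real pi * \<i>)" for w
    define B where "B = {w. w / w0 \<notin> \<real>\<^sub>\<le>\<^sub>0}"
    have "open B"
    proof -
      have "B = (\<lambda>w. w / w0) -` (- \<real>\<^sub>\<le>\<^sub>0)" by (auto simp: B_def)
      moreover have "open \<dots>"
        by (intro open_vimage continuous_intros) (auto simp: w0)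
      ultimately show ?thesis by simp
    qed
    have lB: "l holomorphic_on B"
      unfolding l_def B_def by (intro holomorphic_intros) (auto simp: w0)
    have "open (B \<inter> l -` U)"
      using \<open>open B\<close> \<open>open U\<close> lB
      by (intro continuous_open_preimage holomorphic_on_imp_continuous_on)
    moreover have "w0 \<in> B \<inter> l -` U"
      using z0 w0 by (simp add: B_def l_def)
    moreover have "qexp (l w) = w" if "w \<in> B" for w
    proof -
      have "w \<noteq> 0" using that by (auto simp: B_def)
      then show ?thesis using w0 qexp_Ln[of "w / w0"] by (simp add: l_def qexp_add z0(2))
    qed
    then have "g w = (f \<circ> l) w" if "w \<in> B \<inter> l -` U" for w
      using g[of "l w"] that by simp
    moreover have "(f \<circ> l) holomorphic_on (B \<inter> l -` U)"
      by (rule holomorphic_on_compose_gen[OF holomorphic_on_subset[OF lB] holo]) auto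
    ultimately have "g holomorphic_on (B \<inter> l -` U)"
      using holomorphic_cong by blast
    then have "g field_differentiable at w0"
      using \<open>open (B \<inter> l -` U)\<close> \<open>w0 \<in> B \<inter> l -` U\<close> holomorphic_on_imp_differentiable_at by blast
    then show ?thesis by (rule field_differentiable_at_within)
  qed
  then have "g holomorphic_on qexp ` U" by (simp add: holomorphic_on_def)
  with g show ?thesis by (rule that[rotated])
qed

text \<open>
  Used below with a Cauchy kernel expanded in a geometric series: if every term integrates to zero,
  so does the sum, because a summable majorant permits exchanging sum and integral.
\<close>

lemma contour_integral_series_zero:
  assumes "R > 0" and cont: "\<And>k. continuous_on (sphere 0 R) (f k)"
    and bound: "\<And>k w. norm w = R \<Longrightarrow> norm (f k w) \<le> M k" and M: "summable M"
    and zero: "\<And>k. contour_integral (circlepath 0 R) (f k) = 0"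
    and sums: "\<And>w. norm w = R \<Longrightarrow> (\<lambda>k. f k w) sums l w"
  shows "contour_integral (circlepath 0 R) l = 0"
proof -
  let ?S = "\<lambda>n w. \<Sum>k<n. f k w"
  have int: "f k contour_integrable_on circlepath 0 R" for k
    using cont \<open>R > 0\<close> by (intro contour_integrable_continuous_circlepath) auto
  have "uniform_limit (sphere 0 R) ?S (\<lambda>w. suminf (\<lambda>k. f k w)) sequentially"
    by (rule Weierstrass_m_test) (use bound M in auto)
  moreover have "suminf (\<lambda>k. f k w) = l w" if "w \<in> sphere 0 R" for w
    using sums that sums_unique by fastforce
  ultimately have "uniform_limit (sphere 0 R) ?S l sequentially"
    by (metis (no_types, lifting) uniform_limit_cong')
  then have "(\<lambda>n. contour_integral (circlepath 0 R) (?S n)) \<longlonglongrightarrow> contour_integral (circlepath 0 R) l"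
  proof (intro contour_integral_uniform_limit(2)[where B = "2 * pi * R"])
    show "\<forall>\<^sub>F n in sequentially. ?S n contour_integrable_on circlepath 0 R"
      using int by (intro always_eventually allI contour_integrable_sum) auto
  qed (use \<open>R > 0\<close> in \<open>auto simp: vector_derivative_circlepath norm_mult\<close>)
  moreover have "contour_integral (circlepath 0 R) (?S n) = 0" for n
    using int by (simp add: contour_integral_sum zero)
  ultimately show ?thesis by (simp add: LIMSEQ_const_iff)
qed

text \<open>
  Uniqueness of Laurent expansions on the punctured plane. By Cauchy's formula for an annulus,
  \<open>2 \<pi> i g(u)\<close> is the difference of the integrals of \<open>g(w) / (w - u)\<close> over a large and a small
  circle. On the large circle the kernel expands in negative powers of \<open>w\<close>, on the small circle in
  non-negative powers, so both integrals are combinations of the vanishing moments of \<open>g\<close>.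
\<close>

lemma laurent_coefficients_zero:
  assumes holo: "g holomorphic_on - {0}" and u: "u \<noteq> 0"
    and zero: "\<And>n::int. contour_integral (circlepath 0 1) (\<lambda>w. g w * w powi n) = 0"
  shows "g u = 0"
proof -
  have zeroR: "contour_integral (circlepath 0 R) (\<lambda>w. g w * w powi n) = 0" if "R > 0" for R and n :: int
  proof -
    have h: "(\<lambda>w. g w * w powi n) holomorphic_on UNIV - {0}"
      using holo by (intro holomorphic_intros) (auto simp: Compl_eq_Diff_UNIV)
    show ?thesis
      using contour_integral_circlepath_eq(3)[OF open_UNIV h, of 1 R]
        contour_integral_circlepath_eq(3)[OF open_UNIV h, of R 1] that zero[of n]
      by (cases "R \<le> 1") auto
  qed
  have gcont: "continuous_on (sphere 0 R) g" if "R > 0" for R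
    using that by (intro holomorphic_on_imp_continuous_on holomorphic_on_subset[OF holo]) auto
  have zero_scaled: "contour_integral (circlepath 0 R) (\<lambda>w. c * (g w * w powi n)) = 0"
    if "R > 0" for R c and n :: int
  proof -
    have "contour_integral (circlepath 0 R) (\<lambda>w. c * (g w * w powi n)) =
        c * contour_integral (circlepath 0 R) (\<lambda>w. g w * w powi n)"
      using that by (intro contour_integral_lmul contour_integrable_continuous_circlepath
          continuous_intros gcont) (auto intro!: gcont)
    then show ?thesis using zeroR[OF that] by simp
  qed
  define r where "r = norm u / 2"
  define R where "R = norm u * 2"
  have rR: "0 < r" "r < norm u" "norm u < R" "0 < R" "r \<le> R" using u by (auto simp: r_def R_def)
  have outer: "contour_integral (circlepath 0 R) (\<lambda>w. g w / (w - u)) = 0"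
  proof -
    obtain B where B: "\<And>w. w \<in> sphere 0 R \<Longrightarrow> norm (g w) \<le> B"
      using compact_imp_bounded[OF compact_continuous_image[OF gcont[OF rR(4)] compact_sphere]]
      unfolding bounded_iff by blast
    show ?thesis
    proof (rule contour_integral_series_zero[OF rR(4),
          where f = "\<lambda>k w. u ^ k * (g w * w powi (- int k - 1))"
            and M = "\<lambda>k. (norm u / R) ^ k * (B / R)"])
      show "continuous_on (sphere 0 R) (\<lambda>w. u ^ k * (g w * w powi (- int k - 1)))" for k
        using rR by (intro continuous_intros gcont) auto
      show "contour_integral (circlepath 0 R) (\<lambda>w. u ^ k * (g w * w powi (- int k - 1))) = 0" for k
        by (rule zero_scaled[OF rR(4)])
      show "norm (u ^ k * (g w * w powi (- int k - 1))) \<le> (norm u / R) ^ k * (B / R)"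
        if "norm w = R" for k w
      proof -
        have "w powi (- int k - 1) = inverse w ^ k * inverse w"
          using that rR by (auto simp: power_int_diff power_int_minus field_simps)
        then have "norm (u ^ k * (g w * w powi (- int k - 1))) = (norm u / R) ^ k * (norm (g w) / R)"
          using that by (auto simp: norm_mult norm_power norm_divide field_simps)
        also have "\<dots> \<le> (norm u / R) ^ k * (B / R)"
          using B[of w] that rR by (intro mult_left_mono divide_right_mono) auto
        finally show ?thesis .
      qed
      show "summable (\<lambda>k. (norm u / R) ^ k * (B / R))"
        using rR by (intro summable_mult2 summable_geometric) auto
      show "(\<lambda>k. u ^ k * (g w * w powi (- int k - 1))) sums (g w / (w - u))" if "norm w = R" for w
      proof -
        have w: "w \<noteq> 0" "w \<noteq> u" using that rR by auto
        have "(\<lambda>k. g w / w * (u / w) ^ k) sums (g w / w * (1 / (1 - u / w)))"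
          using that rR by (intro sums_mult geometric_sums) (auto simp: norm_divide)
        moreover have "g w / w * (u / w) ^ k = u ^ k * (g w * w powi (- int k - 1))" for k
          using w by (simp add: power_int_diff power_int_minus field_simps)
        moreover have "g w / w * (1 / (1 - u / w)) = g w / (w - u)"
          using w by (simp add: field_simps)
        ultimately show ?thesis by (simp only:)
      qed
    qed
  qed
  have inner: "contour_integral (circlepath 0 r) (\<lambda>w. g w / (w - u)) = 0"
  proof -
    obtain B where B: "\<And>w. w \<in> sphere 0 r \<Longrightarrow> norm (g w) \<le> B"
      using compact_imp_bounded[OF compact_continuous_image[OF gcont[OF rR(1)] compact_sphere]]
      unfolding bounded_iff by blast
    show ?thesis
    proof (rule contour_integral_series_zero[OF rR(1),
          where f = "\<lambda>k w. (- (1 / u ^ Suc k)) * (g w * w powi int k)"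
            and M = "\<lambda>k. (r / norm u) ^ k * (B / norm u)"])
      show "continuous_on (sphere 0 r) (\<lambda>w. (- (1 / u ^ Suc k)) * (g w * w powi int k))" for k
        using rR by (intro continuous_intros gcont) auto
      show "contour_integral (circlepath 0 r) (\<lambda>w. (- (1 / u ^ Suc k)) * (g w * w powi int k)) = 0" for k
        by (rule zero_scaled[OF rR(1)])
      show "norm ((- (1 / u ^ Suc k)) * (g w * w powi int k)) \<le> (r / norm u) ^ k * (B / norm u)"
        if "norm w = r" for k w
      proof -
        have "norm ((- (1 / u ^ Suc k)) * (g w * w powi int k)) = (r / norm u) ^ k * (norm (g w) / norm u)"
          using that by (simp add: norm_mult norm_power norm_divide field_simps)
        also have "\<dots> \<le> (r / norm u) ^ k * (B / norm u)"
          using B[of w] that rR by (intro mult_left_mono divide_right_mono) auto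
        finally show ?thesis .
      qed
      show "summable (\<lambda>k. (r / norm u) ^ k * (B / norm u))"
        using rR u by (intro summable_mult2 summable_geometric) (auto simp: divide_simps)
      show "(\<lambda>k. (- (1 / u ^ Suc k)) * (g w * w powi int k)) sums (g w / (w - u))" if "norm w = r" for w
      proof -
        have w: "w \<noteq> u" using that rR by auto
        have "(\<lambda>k. - g w / u * (w / u) ^ k) sums (- g w / u * (1 / (1 - w / u)))"
          using that rR u by (intro sums_mult geometric_sums) (auto simp: norm_divide divide_simps)
        moreover have "- g w / u * (w / u) ^ k = (- (1 / u ^ Suc k)) * (g w * w powi int k)" for k
          using u by (simp add: field_simps)
        moreover have "- g w / u * (1 / (1 - w / u)) = g w / (w - u)"
          using w u by (simp add: divide_simps) (simp add: algebra_simps)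
        ultimately show ?thesis by (simp only:)
      qed
    qed
  qed
  \<comment> \<open>The difference quotient has a removable singularity at \<open>u\<close>, so its integrals over the two
    circles agree. This is Cauchy's formula for the annulus.\<close>
  define h where "h w = (if w = u then deriv g u else (g w - g u) / (w - u))" for w
  have "(g has_field_derivative deriv g u) (at u)"
    using holo u by (intro holomorphic_derivI[of _ "- {0}"]) auto
  then have "((\<lambda>w. (g w - g u) / (w - u)) \<longlongrightarrow> deriv g u) (at u)"
    by (simp add: has_field_derivative_iff)
  then have "h holomorphic_on - {0}"
    unfolding h_def using holo
    by (intro removable_singularity)
       (auto intro!: holomorphic_intros holomorphic_on_subset[OF holo])
  then have hh: "h holomorphic_on UNIV - {0}" by (simp add: Compl_eq_Diff_UNIV)
  have eq: "contour_integral (circlepath 0 R) h = contour_integral (circlepath 0 r) h"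
    using contour_integral_circlepath_eq(3)[OF open_UNIV hh, of r R] rR by auto
  have split: "contour_integral (circlepath 0 s) h =
      contour_integral (circlepath 0 s) (\<lambda>w. g w / (w - u)) - g u * contour_integral (circlepath 0 s) (\<lambda>w. 1 / (w - u))"
    if "s > 0" "s \<noteq> norm u" for s
  proof -
    have "contour_integral (circlepath 0 s) h =
        contour_integral (circlepath 0 s) (\<lambda>w. g w / (w - u) - g u * (1 / (w - u)))"
      using that by (intro contour_integral_eq) (auto simp: h_def diff_divide_distrib)
    also have "\<dots> = contour_integral (circlepath 0 s) (\<lambda>w. g w / (w - u)) -
        contour_integral (circlepath 0 s) (\<lambda>w. g u * (1 / (w - u)))"
      using that gcont[of s]
      by (intro contour_integral_diff contour_integrable_continuous_circlepath continuous_intros) auto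
    also have "contour_integral (circlepath 0 s) (\<lambda>w. g u * (1 / (w - u))) =
        g u * contour_integral (circlepath 0 s) (\<lambda>w. 1 / (w - u))"
      using that
      by (intro contour_integral_lmul contour_integrable_continuous_circlepath continuous_intros) auto
    finally show ?thesis .
  qed
  have "contour_integral (circlepath 0 R) (\<lambda>w. 1 / (w - u)) = 2 * of_real pi * \<i>"
    using Cauchy_integral_circlepath_simple[of "\<lambda>_. 1" 0 R u] rR
    by (auto intro: contour_integral_unique)
  moreover have "contour_integral (circlepath 0 r) (\<lambda>w. 1 / (w - u)) = 0"
    using rR by (intro contour_integral_unique Cauchy_theorem_convex_simple[of _ "cball 0 r"])
       (auto intro!: holomorphic_intros)
  ultimately show "g u = 0"
    using eq split[of R] split[of r] rR outer inner by auto
qed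

section \<open>Fourier coefficients of entire periodic functions\<close>

text \<open>
  The mean over a horizontal period is \<open>P (z + 1) - P z\<close> for a primitive \<open>P\<close>, and periodicity says
  exactly that this expression has derivative zero in \<open>z\<close>.
\<close>

lemma periodic_mean_shift:
  assumes holo: "G holomorphic_on UNIV" and per: "\<And>z. G (z + 1) = G z"
  shows "integral {0..1} (\<lambda>x. G (z + of_real x)) = integral {0..1} (\<lambda>x. G (of_real x))"
proof -
  obtain P where "\<And>z. z \<in> UNIV \<Longrightarrow> (P has_field_derivative G z) (at z within UNIV)"
    using holomorphic_convex_primitive'[OF convex_UNIV open_UNIV holo] by metis
  then have P: "(P has_field_derivative G z) (at z)" for z by simp
  have int: "integral {0..1} (\<lambda>x. G (z + of_real x)) = P (z + 1) - P z" for z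
  proof -
    have "((\<lambda>x. G (z + of_real x)) has_integral P (z + of_real 1) - P (z + of_real 0)) {0..1}"
    proof (rule fundamental_theorem_of_calculus)
      fix x :: real
      have "((\<lambda>w. P (z + w)) has_field_derivative G (z + of_real x) * 1) (at (of_real x))"
        by (rule DERIV_chain2[OF P]) (auto intro!: derivative_eq_intros)
      then show "((\<lambda>x. P (z + of_real x)) has_vector_derivative G (z + of_real x)) (at x within {0..1})"
        by (intro has_vector_derivative_real_field) simp
    qed simp
    then show ?thesis by (simp add: integral_unique)
  qed
  have "\<exists>c. \<forall>z\<in>UNIV. P (z + 1) - P z = c"
  proof (rule has_field_derivative_zero_constant)
    fix z
    have "((\<lambda>z. P (z + 1) - P z) has_field_derivative G (z + 1) * 1 - G z) (at z)"
      by (intro DERIV_diff DERIV_chain2[of P] P) (auto intro!: derivative_eq_intros)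
    then show "((\<lambda>z. P (z + 1) - P z) has_field_derivative 0) (at z within UNIV)"
      by (simp add: per)
  qed simp
  then obtain c where "P (z + 1) - P z = c" "P (0 + 1) - P 0 = c" by blast
  then show ?thesis using int[of z] int[of 0] by simp
qed

lemma fourier_coefficients_zero:
  assumes holo: "F holomorphic_on UNIV" and per: "\<And>z. F (z + 1) = F z"
    and zero: "\<And>n::int. integral {0..1} (\<lambda>x. F (of_real x) * qexp (of_int n * of_real x)) = 0"
  shows "F z = 0"
proof -
  have U: "z + 1 \<in> UNIV \<longleftrightarrow> z \<in> UNIV" for z :: complex by simp
  have f: "F (z + 1) = F z" if "z \<in> UNIV" for z by (rule per)
  obtain g where g: "g holomorphic_on range qexp" "\<And>z. z \<in> UNIV \<Longrightarrow> g (qexp z) = F z"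
    using periodic_factor[of UNIV F, OF open_UNIV holo U f] by metis
  have "range qexp = - {0}"
  proof (intro equalityI subsetI)
    fix w :: complex assume "w \<in> - {0}"
    then show "w \<in> range qexp" using qexp_Ln[of w] by (metis ComplD rangeI singletonI)
  qed auto
  with g have holo_g: "g holomorphic_on - {0}" by simp
  have "contour_integral (circlepath 0 1) (\<lambda>w. g w * w powi n) = 0" for n
  proof -
    have "contour_integral (circlepath 0 1) (\<lambda>w. g w * w powi n) =
        integral {0..1} (\<lambda>x. (2 * of_real pi * \<i>) * (F (of_real x) * qexp (of_int (n + 1) * of_real x)))"
      unfolding contour_integral_integral
    proof (rule integral_cong)
      fix x :: real
      have "circlepath 0 1 x = qexp (of_real x)" by (simp add: circlepath qexp_def)
      moreover have "vector_derivative (circlepath 0 1) (at x) = 2 * of_real pi * \<i> * qexp (of_real x)"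
        by (simp add: vector_derivative_circlepath qexp_def)
      moreover have "qexp (of_real x) powi n * qexp (of_real x) = qexp (of_int (n + 1) * of_real x)"
        by (simp add: qexp_def exp_power_int exp_add [symmetric] algebra_simps)
      ultimately show "g (circlepath 0 1 x) * circlepath 0 1 x powi n * vector_derivative (circlepath 0 1) (at x) =
          (2 * of_real pi * \<i>) * (F (of_real x) * qexp (of_int (n + 1) * of_real x))"
        by (simp add: g mult_ac)
    qed
    then show ?thesis by (simp only: integral_mult_right zero mult_zero_right)
  qed
  from laurent_coefficients_zero[OF holo_g _ this, of "qexp z"] g show ?thesis by simp
qed

text \<open>
  Shifting the period by \<open>\<tau>\<close> does not change a Fourier coefficient, while the quasi-periodicity
  factor turns each coefficient into a non-zero multiple of its neighbour. Hence one vanishing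
  coefficient makes all of them vanish.
\<close>

lemma quasi_periodic_mean_zero:
  assumes holo: "F holomorphic_on UNIV" and per: "\<And>z. F (z + 1) = F z"
    and quasi: "\<And>z. F (z + \<tau>) = exp (- of_real pi * \<i> * (\<tau> + 2 * z)) * F z"
    and mean: "integral {0..1} (\<lambda>x. F (of_real x)) = 0"
  shows "F z = 0"
proof (rule fourier_coefficients_zero[OF holo per])
  define a where "a n = integral {0..1} (\<lambda>x. F (of_real x) * qexp (of_int n * of_real x))" for n :: int
  have holo_n: "(\<lambda>z. F z * qexp (of_int n * z)) holomorphic_on UNIV" for n
    using holo by (intro holomorphic_intros)
  have per_n: "F (z + 1) * qexp (of_int n * (z + 1)) = F z * qexp (of_int n * z)" for z n
    by (simp add: per ring_distribs qexp_add)
  have rec: "a n = exp (- of_real pi * \<i> * \<tau>) * qexp (of_int n * \<tau>) * a (n - 1)" for n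
  proof -
    have "a n = integral {0..1} (\<lambda>x. F (\<tau> + of_real x) * qexp (of_int n * (\<tau> + of_real x)))"
      unfolding a_def by (rule periodic_mean_shift[OF holo_n per_n, symmetric])
    also have "\<dots> = integral {0..1} (\<lambda>x. exp (- of_real pi * \<i> * \<tau>) * qexp (of_int n * \<tau>) *
        (F (of_real x) * qexp (of_int (n - 1) * of_real x)))"
    proof (rule integral_cong)
      fix x :: real
      have "F (\<tau> + of_real x) = exp (- of_real pi * \<i> * \<tau>) * qexp (- of_real x) * F (of_real x)"
        unfolding add.commute[of \<tau>] quasi
        by (simp add: qexp_def exp_add [symmetric] algebra_simps)
      moreover have "qexp (- of_real x) * qexp (of_int n * (\<tau> + of_real x)) =
          qexp (of_int n * \<tau>) * qexp (of_int (n - 1) * of_real x)"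
        by (simp add: qexp_add [symmetric] algebra_simps)
      ultimately show "F (\<tau> + of_real x) * qexp (of_int n * (\<tau> + of_real x)) =
        exp (- of_real pi * \<i> * \<tau>) * qexp (of_int n * \<tau>) * (F (of_real x) * qexp (of_int (n - 1) * of_real x))"
        by (simp add: mult_ac)
    qed
    finally show ?thesis by (simp only: integral_mult_right a_def)
  qed
  have step: "a n = 0 \<longleftrightarrow> a (n - 1) = 0" for n
    using rec[of n] by simp
  have "a n = 0" for n
  proof (induction n rule: int_induct[where k=0])
    case base
    then show ?case using mean by (simp add: a_def)
  next
    case (step1 i)
    then show ?case using step[of "i + 1"] by simp
  next
    case (step2 i)
    then show ?case using step[of i] by simp
  qed
  then show "integral {0..1} (\<lambda>x. F (of_real x) * qexp (of_int n * of_real x)) = 0" for n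
    by (simp add: a_def)
qed

section \<open>The theta function and its inversion\<close>

text \<open>
  Jacobi's theta function of two variables. Although only theta constants occur in \<open>\<lambda>\<close>, the variable
  \<open>z\<close> is what makes the inversion formula accessible.
\<close>

definition jtheta :: "complex \<Rightarrow> complex \<Rightarrow> complex" where
  "jtheta z \<tau> = (\<Sum>\<^sub>\<infinity>n\<in>(UNIV :: int set). exp (of_real pi * \<i> * ((of_int n)\<^sup>2 * \<tau> + 2 * of_int n * z)))"

lemma has_sum_geometric_int:
  fixes r :: real
  assumes "0 \<le> r" "r < 1"
  shows "((\<lambda>n::int. r ^ nat \<bar>n\<bar>) has_sum (2 * r / (1 - r))) (UNIV - {0})"
proof -
  have geo: "((\<lambda>n. r ^ n) has_sum (r / (1 - r))) {1..}"
    using assms by (intro has_sum_geometric_from_1) auto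
  have "((\<lambda>n::int. r ^ nat \<bar>n\<bar>) has_sum (r / (1 - r))) {1..}"
    by (rule has_sum_reindex_bij_witness[of _ int nat, THEN iffD2, OF _ _ _ _ _ _ geo]) auto
  moreover have "((\<lambda>n::int. r ^ nat \<bar>n\<bar>) has_sum (r / (1 - r))) {..-1}"
    by (rule has_sum_reindex_bij_witness[of _ "\<lambda>k. - int k" "\<lambda>k. nat (- k)", THEN iffD2, OF _ _ _ _ _ _ geo]) auto
  ultimately have "((\<lambda>n::int. r ^ nat \<bar>n\<bar>) has_sum (r / (1 - r) + r / (1 - r))) ({1..} \<union> {..-1})"
    by (rule has_sum_Un_disjoint) auto
  moreover have "{1..} \<union> {..-1} = UNIV - {0::int}" by auto
  ultimately show ?thesis by simp
qed

lemma summable_geometric_int: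
  fixes r :: real
  assumes "0 \<le> r" "r < 1"
  shows "(\<lambda>n::int. r ^ nat \<bar>n\<bar>) summable_on UNIV"
proof -
  have "(\<lambda>n::int. r ^ nat \<bar>n\<bar>) summable_on (UNIV - {0}) \<union> {0}"
    using has_sum_geometric_int[OF assms]
    by (intro summable_on_Un_disjoint summable_on_finite has_sum_imp_summable) auto
  then show ?thesis by simp
qed

text \<open>
  A quadratic exponent eventually dominates any linear one; completing the square gives an explicit
  constant \<open>C\<close> with \<open>\<pi> (t\<^sup>2 \<delta> - 2 t B) \<ge> t - C\<close> and reduces the claim to a geometric series.
\<close>

lemma summable_gaussian:
  assumes "\<delta> > 0"
  shows "(\<lambda>n::int. exp (- (pi * (real_of_int n ^ 2 * \<delta> - 2 * \<bar>real_of_int n\<bar> * B)))) summable_on UNIV"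
proof -
  define C where "C = (2 * pi * B + 1)\<^sup>2 / (4 * pi * \<delta>)"
  have bound: "- (pi * (t ^ 2 * \<delta> - 2 * t * B)) \<le> C - t" for t :: real
  proof -
    have "0 \<le> (2 * pi * \<delta> * t - (2 * pi * B + 1))\<^sup>2" by simp
    also have "\<dots> = 4 * pi * \<delta> * (pi * (t ^ 2 * \<delta> - 2 * t * B) + C - t)"
      using assms by (simp add: C_def power2_eq_square field_simps)
    finally have "0 \<le> 4 * pi * \<delta> * (pi * (t ^ 2 * \<delta> - 2 * t * B) + C - t)" .
    moreover have "0 < 4 * pi * \<delta>" using assms by simp
    ultimately have "0 \<le> pi * (t ^ 2 * \<delta> - 2 * t * B) + C - t"
      unfolding zero_le_mult_iff by linarith
    then show ?thesis by simp
  qed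
  have "(\<lambda>n::int. exp C * exp (-1) ^ nat \<bar>n\<bar>) summable_on UNIV"
    by (intro summable_on_cmult_right summable_geometric_int) auto
  then show ?thesis
  proof (rule summable_on_comparison_test)
    fix n :: int
    have "exp (- (pi * (real_of_int n ^ 2 * \<delta> - 2 * \<bar>real_of_int n\<bar> * B))) \<le> exp (C - \<bar>real_of_int n\<bar>)"
      using bound[of "\<bar>real_of_int n\<bar>"] by simp
    also have "\<dots> = exp C * exp (-1) ^ nat \<bar>n\<bar>"
      by (simp add: exp_diff exp_minus exp_of_nat_mult [symmetric] field_simps flip: exp_add)
    finally show "exp (- (pi * (real_of_int n ^ 2 * \<delta> - 2 * \<bar>real_of_int n\<bar> * B))) \<le> exp C * exp (-1) ^ nat \<bar>n\<bar>" .
  qed auto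
qed

lemma norm_theta_term_le:
  assumes "\<delta> \<le> Im \<tau>" "\<bar>Im z\<bar> \<le> B"
  shows "norm (exp (of_real pi * \<i> * ((of_int n)\<^sup>2 * \<tau> + 2 * of_int n * z)))
      \<le> exp (- (pi * (real_of_int n ^ 2 * \<delta> - 2 * \<bar>real_of_int n\<bar> * B)))"
proof -
  have "Re (of_real pi * \<i> * ((of_int n)\<^sup>2 * \<tau> + 2 * of_int n * z)) =
      - (pi * (real_of_int n ^ 2 * Im \<tau> + 2 * real_of_int n * Im z))"
    by (simp add: power2_eq_square)
  moreover have "real_of_int n ^ 2 * \<delta> \<le> real_of_int n ^ 2 * Im \<tau>"
    using assms by (intro mult_left_mono) auto
  moreover have "- (real_of_int n * Im z) \<le> \<bar>real_of_int n\<bar> * B"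
  proof -
    have "- (real_of_int n * Im z) \<le> \<bar>real_of_int n * Im z\<bar>" by simp
    also have "\<dots> \<le> \<bar>real_of_int n\<bar> * B" unfolding abs_mult using assms by (intro mult_left_mono) auto
    finally show ?thesis .
  qed
  ultimately show ?thesis by simp
qed

lemma theta_summable:
  assumes "Im \<tau> > 0"
  shows "(\<lambda>n::int. exp (of_real pi * \<i> * ((of_int n)\<^sup>2 * \<tau> + 2 * of_int n * z))) summable_on UNIV"
proof (rule abs_summable_summable, rule summable_on_comparison_test[OF summable_gaussian[OF assms]])
  show "norm (exp (of_real pi * \<i> * ((of_int n)\<^sup>2 * \<tau> + 2 * of_int n * z)))
      \<le> exp (- (pi * (real_of_int n ^ 2 * Im \<tau> - 2 * \<bar>real_of_int n\<bar> * \<bar>Im z\<bar>)))" for n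
    by (rule norm_theta_term_le) auto
qed auto

lemma theta_uniform_limit:
  assumes "\<delta> > 0" and "\<And>s. s \<in> Y \<Longrightarrow> \<delta> \<le> Im (\<tau> s)" and "\<And>s. s \<in> Y \<Longrightarrow> \<bar>Im (z s)\<bar> \<le> B"
  shows "uniform_limit Y
     (\<lambda>X s. \<Sum>n\<in>X. exp (of_real pi * \<i> * ((of_int n)\<^sup>2 * \<tau> s + 2 * of_int n * z s)))
     (\<lambda>s. jtheta (z s) (\<tau> s)) (finite_subsets_at_top (UNIV :: int set))"
  unfolding jtheta_def
proof (rule Weierstrass_m_test_general)
  show "norm (exp (of_real pi * \<i> * ((of_int n)\<^sup>2 * \<tau> s + 2 * of_int n * z s)))
      \<le> exp (- (pi * (real_of_int n ^ 2 * \<delta> - 2 * \<bar>real_of_int n\<bar> * B)))" if "s \<in> Y" for n s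
    using that assms by (intro norm_theta_term_le)
qed (rule summable_gaussian[OF assms(1)])

lemma jtheta_holomorphic:
  assumes "open S" and z: "z holomorphic_on S" and \<tau>: "\<tau> holomorphic_on S"
    and pos: "\<And>s. s \<in> S \<Longrightarrow> Im (\<tau> s) > 0"
  shows "(\<lambda>s. jtheta (z s) (\<tau> s)) holomorphic_on S"
proof -
  have "(\<lambda>s. jtheta (z s) (\<tau> s)) field_differentiable at s0" if s0: "s0 \<in> S" for s0
  proof -
    obtain r where r: "r > 0" "cball s0 r \<subseteq> S"
      using \<open>open S\<close> s0 open_contains_cball by blast
    have cont: "continuous_on (cball s0 r) z" "continuous_on (cball s0 r) \<tau>"
      using z \<tau> r holomorphic_on_imp_continuous_on continuous_on_subset by blast+
    have "\<exists>x\<in>cball s0 r. \<forall>y\<in>cball s0 r. Im (\<tau> x) \<le> Im (\<tau> y)"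
      using r by (intro continuous_attains_inf continuous_intros cont) auto
    then obtain x where x: "x \<in> cball s0 r" "\<And>y. y \<in> cball s0 r \<Longrightarrow> Im (\<tau> x) \<le> Im (\<tau> y)" by blast
    have "bounded ((\<lambda>s. Im (z s)) ` cball s0 r)"
      by (intro compact_imp_bounded compact_continuous_image continuous_intros cont) auto
    then obtain B where B: "\<And>y. y \<in> cball s0 r \<Longrightarrow> \<bar>Im (z y)\<bar> \<le> B"
      unfolding bounded_iff real_norm_def by blast
    have "(\<lambda>s. jtheta (z s) (\<tau> s)) holomorphic_on ball s0 r"
    proof (rule holomorphic_uniform_limit)
      show "uniform_limit (cball s0 r)
         (\<lambda>X s. \<Sum>n\<in>X. exp (of_real pi * \<i> * ((of_int n)\<^sup>2 * \<tau> s + 2 * of_int n * z s)))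
         (\<lambda>s. jtheta (z s) (\<tau> s)) (finite_subsets_at_top (UNIV :: int set))"
        using x B pos r by (intro theta_uniform_limit[of "Im (\<tau> x)" _ _ _ B]) auto
      have "ball s0 r \<subseteq> S" using r ball_subset_cball by blast
      then show "\<forall>\<^sub>F X in finite_subsets_at_top UNIV.
          continuous_on (cball s0 r) (\<lambda>s. \<Sum>n\<in>X. exp (of_real pi * \<i> * ((of_int n)\<^sup>2 * \<tau> s + 2 * of_int n * z s))) \<and>
          (\<lambda>s. \<Sum>n\<in>X. exp (of_real pi * \<i> * ((of_int n)\<^sup>2 * \<tau> s + 2 * of_int n * z s))) holomorphic_on ball s0 r"
        by (intro always_eventually allI conjI continuous_intros holomorphic_intros cont
            holomorphic_on_subset[OF z] holomorphic_on_subset[OF \<tau>])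
    qed auto
    then show ?thesis
      using r by (intro holomorphic_on_imp_differentiable_at[of _ "ball s0 r"]) auto
  qed
  then show ?thesis
    unfolding holomorphic_on_def using field_differentiable_at_within by blast
qed

lemma exp_add_2pi_of_int: "exp (w + 2 * of_real pi * \<i> * of_int n) = exp w"
  by (simp only: exp_add qexp_of_int[unfolded qexp_def] mult_1_right)

lemma jtheta_add_1: "jtheta (z + 1) \<tau> = jtheta z \<tau>"
  unfolding jtheta_def
proof (rule infsum_cong)
  fix n :: int
  show "exp (of_real pi * \<i> * ((of_int n)\<^sup>2 * \<tau> + 2 * of_int n * (z + 1))) =
      exp (of_real pi * \<i> * ((of_int n)\<^sup>2 * \<tau> + 2 * of_int n * z))"
    by (subst (2) exp_add_2pi_of_int [of _ n, symmetric], rule arg_cong[of _ _ exp])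
       (simp add: algebra_simps)
qed

lemma jtheta_add_tau: "jtheta (z + \<tau>) \<tau> = exp (- of_real pi * \<i> * (\<tau> + 2 * z)) * jtheta z \<tau>"
proof -
  let ?f = "\<lambda>n::int. exp (of_real pi * \<i> * ((of_int n)\<^sup>2 * \<tau> + 2 * of_int n * z))"
  have "jtheta (z + \<tau>) \<tau> = (\<Sum>\<^sub>\<infinity>n::int. exp (- of_real pi * \<i> * (\<tau> + 2 * z)) * ?f (n + 1))"
    unfolding jtheta_def
    by (rule infsum_cong) (simp add: exp_add [symmetric] algebra_simps power2_eq_square)
  also have "\<dots> = exp (- of_real pi * \<i> * (\<tau> + 2 * z)) * (\<Sum>\<^sub>\<infinity>n. ?f (n + 1))"
    by (rule infsum_cmult_right')
  also have "(\<Sum>\<^sub>\<infinity>n. ?f (n + 1)) = jtheta z \<tau>"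
    unfolding jtheta_def
    by (rule infsum_reindex_bij_witness[of _ "\<lambda>n. n - 1" "\<lambda>n. n + 1"]) auto
  finally show ?thesis .
qed

lemma jtheta_minus: "jtheta (- z) \<tau> = jtheta z \<tau>"
  unfolding jtheta_def
  by (rule infsum_reindex_bij_witness[of _ uminus uminus]) auto

lemma jtheta_tau_add_1: "jtheta z (\<tau> + 1) = jtheta (z + 1 / 2) \<tau>"
  unfolding jtheta_def
proof (rule infsum_cong)
  fix n :: int
  have "even (n\<^sup>2 - n)" by (simp add: power2_eq_square)
  then obtain k where k: "n\<^sup>2 - n = 2 * k" by (elim evenE)
  have "(of_int n)\<^sup>2 = (of_int n + 2 * of_int k :: complex)"
  proof -
    have "n\<^sup>2 = n + 2 * k" using k by simp
    then show ?thesis by (metis of_int_add of_int_mult of_int_numeral of_int_power)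
  qed
  then show "exp (of_real pi * \<i> * ((of_int n)\<^sup>2 * (\<tau> + 1) + 2 * of_int n * z)) =
      exp (of_real pi * \<i> * ((of_int n)\<^sup>2 * \<tau> + 2 * of_int n * (z + 1 / 2)))"
    by (subst (2) exp_add_2pi_of_int [of _ k, symmetric], intro arg_cong[of _ _ exp])
       (simp add: algebra_simps)
qed

text \<open>
  Only the term of index 0 contributes to the mean. In particular \<open>jtheta\<close> is not identically zero
  in \<open>z\<close>, for any \<open>\<tau>\<close> in the upper half-plane.
\<close>

lemma jtheta_mean:
  assumes "Im \<tau> > 0"
  shows "integral {0..1} (\<lambda>x. jtheta (of_real x) \<tau>) = 1"
proof -
  let ?t = "\<lambda>(n::int) x::real. exp (of_real pi * \<i> * ((of_int n)\<^sup>2 * \<tau> + 2 * of_int n * of_real x))"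
  have term_int: "(?t n has_integral (if n = 0 then 1 else 0)) {0..1}" for n
  proof (cases "n = 0")
    case True
    then show ?thesis using has_integral_const_real[of "1::complex" 0 1] by simp
  next
    case False
    let ?c = "2 * of_real pi * \<i> * of_int n :: complex"
    have "(?t n has_integral ?t n 1 / ?c - ?t n 0 / ?c) {0..1}"
    proof (rule fundamental_theorem_of_calculus)
      fix x :: real
      have "((\<lambda>z. exp (of_real pi * \<i> * ((of_int n)\<^sup>2 * \<tau> + 2 * of_int n * z)) / ?c) has_field_derivative ?t n x) (at (of_real x))"
        using False by (auto intro!: derivative_eq_intros)
      then show "((\<lambda>x. ?t n x / ?c) has_vector_derivative ?t n x) (at x within {0..1})"
        by (rule has_vector_derivative_real_field)
    qed simp
    moreover have "?t n 1 = ?t n 0"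
    proof -
      show ?thesis
        by (subst (2) exp_add_2pi_of_int [of _ n, symmetric], rule arg_cong[of _ _ exp])
           (simp add: algebra_simps)
    qed
    ultimately show ?thesis using False by simp
  qed
  have lim: "uniform_limit {0..1} (\<lambda>X x. \<Sum>n\<in>X. ?t n x) (\<lambda>x. jtheta (of_real x) \<tau>) (finite_subsets_at_top UNIV)"
    by (rule theta_uniform_limit[where \<tau> = "\<lambda>_. \<tau>" and \<delta> = "Im \<tau>" and B = 0]) (use assms in auto)
  have cont: "continuous_on {0..1} (\<lambda>x. \<Sum>n\<in>X. ?t n x)" for X
    by (intro continuous_intros)
  have "\<exists>I J. (\<forall>X. ((\<lambda>x. \<Sum>n\<in>X. ?t n x) has_integral I X) {0..1}) \<and>
      ((\<lambda>x. jtheta (of_real x) \<tau>) has_integral J) {0..1} \<and> (I \<longlongrightarrow> J) (finite_subsets_at_top UNIV)"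
    by (rule uniform_limit_integral[OF lim cont finite_subsets_at_top_neq_bot]) (intro exI conjI allI; assumption)
  then obtain I J where IJ: "\<And>X. ((\<lambda>x. \<Sum>n\<in>X. ?t n x) has_integral I X) {0..1}"
    "((\<lambda>x. jtheta (of_real x) \<tau>) has_integral J) {0..1}"
    "(I \<longlongrightarrow> J) (finite_subsets_at_top UNIV)"
    by auto
  have "I X = 1" if "finite X" "0 \<in> X" for X
  proof -
    have "((\<lambda>x. \<Sum>n\<in>X. ?t n x) has_integral (\<Sum>n\<in>X. if n = 0 then 1 else 0)) {0..1}"
      using that by (intro has_integral_sum term_int) auto
    moreover have "(\<Sum>n\<in>X. if n = 0 then 1 else 0) = (1 :: complex)" using that by simp
    ultimately show ?thesis using has_integral_unique[OF IJ(1)] by simp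
  qed
  then have "\<forall>\<^sub>F X in finite_subsets_at_top UNIV. I X = 1"
    unfolding eventually_finite_subsets_at_top by (intro exI[of _ "{0}"]) auto
  then have "(I \<longlongrightarrow> 1) (finite_subsets_at_top UNIV)" by (rule tendsto_eventually)
  then have "J = 1" using IJ(3) by (intro tendsto_unique[OF finite_subsets_at_top_neq_bot])
  then show ?thesis using IJ(2) by (simp add: integral_unique)
qed

text \<open>
  The space of entire functions with the periodicity behaviour of \<open>jtheta\<close> is one-dimensional: after
  subtracting the multiple of \<open>jtheta\<close> with the same mean, nothing remains.
\<close>

lemma quasi_periodic_multiple_of_jtheta:
  assumes "Im \<tau> > 0" and holo: "F holomorphic_on UNIV" and per: "\<And>z. F (z + 1) = F z"
    and quasi: "\<And>z. F (z + \<tau>) = exp (- of_real pi * \<i> * (\<tau> + 2 * z)) * F z"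
  shows "\<exists>c. \<forall>z. F z = c * jtheta z \<tau>"
proof -
  define c where "c = integral {0..1} (\<lambda>x. F (of_real x))"
  have th: "(\<lambda>z. jtheta z \<tau>) holomorphic_on UNIV"
    using assms(1) by (intro jtheta_holomorphic holomorphic_intros) auto
  have "F z - c * jtheta z \<tau> = 0" for z
  proof (rule quasi_periodic_mean_zero[where F = "\<lambda>z. F z - c * jtheta z \<tau>" and \<tau> = \<tau>])
    show "(\<lambda>z. F z - c * jtheta z \<tau>) holomorphic_on UNIV"
      by (intro holomorphic_on_diff holomorphic_on_mult holomorphic_on_const holo th)
    have "continuous_on {0..1} (\<lambda>x. G (complex_of_real x))" if "G holomorphic_on UNIV" for G
      by (rule continuous_on_compose2[OF holomorphic_on_imp_continuous_on[OF that]])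
         (auto intro!: continuous_intros)
    then have "(\<lambda>x. F (of_real x)) integrable_on {0..1}" "(\<lambda>x. jtheta (of_real x) \<tau>) integrable_on {0..1}"
      using holo th by (auto intro!: integrable_continuous_real)
    then show "integral {0..1} (\<lambda>x. F (of_real x) - c * jtheta (of_real x) \<tau>) = 0"
      using jtheta_mean[OF assms(1)] by (subst integral_diff) (auto simp: c_def integrable_on_mult_right)
    show "F (z + 1) - c * jtheta (z + 1) \<tau> = F z - c * jtheta z \<tau>" for z
      by (simp only: per jtheta_add_1)
    show "F (z + \<tau>) - c * jtheta (z + \<tau>) \<tau> =
        exp (- of_real pi * \<i> * (\<tau> + 2 * z)) * (F z - c * jtheta z \<tau>)" for z
      by (simp only: quasi jtheta_add_tau right_diff_distrib mult.left_commute)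
  qed
  then have "F z = c * jtheta z \<tau>" for z by (metis eq_iff_diff_eq_0)
  then show ?thesis by blast
qed

text \<open>
  The left-hand side has the periodicity behaviour of \<open>jtheta\<close> for \<open>\<tau>\<close>, the roles of the two periods
  being exchanged by \<open>\<tau> \<mapsto> -1/\<tau>\<close>. The constant is a square root of \<open>-i \<tau>\<close>, but since \<open>\<lambda>\<close> is a
  quotient, it suffices that it is non-zero and the same for all \<open>z\<close>.
\<close>

lemma jtheta_inversion:
  assumes "Im \<tau> > 0"
  shows "\<exists>c. c \<noteq> 0 \<and>
    (\<forall>z. exp (- of_real pi * \<i> * z\<^sup>2 / \<tau>) * jtheta (z / \<tau>) (- 1 / \<tau>) = c * jtheta z \<tau>)"
proof -
  have [simp]: "\<tau> \<noteq> 0" using assms by force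
  have im: "Im (- 1 / \<tau>) > 0"
    using assms by (simp only: Im_complex_div_gt_0) simp
  define F where "F z = exp (- of_real pi * \<i> * z\<^sup>2 / \<tau>) * jtheta (z / \<tau>) (- 1 / \<tau>)" for z
  have holo: "F holomorphic_on UNIV"
    unfolding F_def using im by (intro holomorphic_intros jtheta_holomorphic) auto
  have per: "F (z + 1) = F z" for z
  proof -
    have "jtheta (z / \<tau>) (- 1 / \<tau>) = jtheta ((z + 1) / \<tau> + (- 1 / \<tau>)) (- 1 / \<tau>)"
      by (simp add: add_divide_distrib)
    also have "\<dots> = exp (of_real pi * \<i> * (- 1 - 2 * z) / \<tau>) * jtheta ((z + 1) / \<tau>) (- 1 / \<tau>)"
    proof -
      have "- of_real pi * \<i> * (- 1 / \<tau> + 2 * ((z + 1) / \<tau>)) = of_real pi * \<i> * (- 1 - 2 * z) / \<tau>"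
        by (simp add: divide_simps) (simp add: algebra_simps)
      then show ?thesis by (simp only: jtheta_add_tau)
    qed
    finally have 1: "jtheta (z / \<tau>) (- 1 / \<tau>) =
        exp (of_real pi * \<i> * (- 1 - 2 * z) / \<tau>) * jtheta ((z + 1) / \<tau>) (- 1 / \<tau>)" .
    have 2: "- of_real pi * \<i> * (z + 1)\<^sup>2 / \<tau> =
        - of_real pi * \<i> * z\<^sup>2 / \<tau> + of_real pi * \<i> * (- 1 - 2 * z) / \<tau>"
      by (simp add: divide_simps) (simp add: power2_eq_square algebra_simps)
    show ?thesis
      unfolding F_def 1 2 exp_add by (rule mult.assoc)
  qed
  have quasi: "F (z + \<tau>) = exp (- of_real pi * \<i> * (\<tau> + 2 * z)) * F z" for z
  proof -
    have "jtheta ((z + \<tau>) / \<tau>) (- 1 / \<tau>) = jtheta (z / \<tau>) (- 1 / \<tau>)"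
      using jtheta_add_1[of "z / \<tau>"] by (simp add: add_divide_distrib)
    moreover have "- of_real pi * \<i> * (z + \<tau>)\<^sup>2 / \<tau> =
        - of_real pi * \<i> * (\<tau> + 2 * z) + - of_real pi * \<i> * z\<^sup>2 / \<tau>"
      by (simp add: divide_simps) (simp add: power2_eq_square algebra_simps)
    ultimately show ?thesis
      unfolding F_def by (simp only: exp_add mult.assoc)
  qed
  obtain c where c: "\<And>z. F z = c * jtheta z \<tau>"
    using quasi_periodic_multiple_of_jtheta[OF assms holo per quasi] by blast
  have "c \<noteq> 0"
  proof
    assume "c = 0"
    then have "jtheta (z / \<tau>) (- 1 / \<tau>) = 0" for z
      using c[of z] by (simp add: F_def)
    from this[of "z * \<tau>" for z] have "jtheta z (- 1 / \<tau>) = 0" for z by simp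
    then show False using jtheta_mean[OF im] by simp
  qed
  with c show ?thesis unfolding F_def by blast
qed


section \<open>Theta constants\<close>

lemma theta_const_0_0: "theta_const 0 0 \<tau> = jtheta 0 \<tau>"
  unfolding theta_const_def jtheta_def
  by (intro infsum_cong arg_cong[of _ _ exp]) (simp add: algebra_simps)

lemma theta_const_0_1: "theta_const 0 1 \<tau> = jtheta (1 / 2) \<tau>"
  unfolding theta_const_def jtheta_def
  by (intro infsum_cong arg_cong[of _ _ exp]) (simp add: algebra_simps)

lemma theta_const_1_0: "theta_const 1 0 \<tau> = exp (of_real pi * \<i> * \<tau> / 4) * jtheta (\<tau> / 2) \<tau>"
  unfolding theta_const_def jtheta_def infsum_cmult_right' [symmetric] exp_add [symmetric]
  by (intro infsum_cong arg_cong[of _ _ exp]) (simp add: power2_eq_square field_simps)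

lemma theta_const_holomorphic:
  "theta_const 0 0 holomorphic_on {\<tau>. Im \<tau> > 0}"
  "theta_const 0 1 holomorphic_on {\<tau>. Im \<tau> > 0}"
  "theta_const 1 0 holomorphic_on {\<tau>. Im \<tau> > 0}"
  unfolding theta_const_0_0[abs_def] theta_const_0_1[abs_def] theta_const_1_0[abs_def]
  by (intro holomorphic_intros jtheta_holomorphic open_halfspace_Im_gt; simp)+

lemma theta_const_add_1:
  "theta_const 0 0 (\<tau> + 1) = theta_const 0 1 \<tau>"
  "theta_const 0 1 (\<tau> + 1) = theta_const 0 0 \<tau>"
  "theta_const 1 0 (\<tau> + 1) = exp (of_real pi * \<i> / 4) * theta_const 1 0 \<tau>"
proof -
  show "theta_const 0 0 (\<tau> + 1) = theta_const 0 1 \<tau>"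
    by (simp add: theta_const_0_0 theta_const_0_1 jtheta_tau_add_1)
  show "theta_const 0 1 (\<tau> + 1) = theta_const 0 0 \<tau>"
    using jtheta_add_1[of 0 \<tau>] by (simp add: theta_const_0_0 theta_const_0_1 jtheta_tau_add_1)
  have "jtheta ((\<tau> + 1) / 2) (\<tau> + 1) = jtheta (\<tau> / 2 + 1) \<tau>"
    unfolding jtheta_tau_add_1 by (rule arg_cong[of _ _ "\<lambda>z. jtheta z \<tau>"]) (simp add: field_simps)
  then show "theta_const 1 0 (\<tau> + 1) = exp (of_real pi * \<i> / 4) * theta_const 1 0 \<tau>"
    by (simp add: theta_const_1_0 jtheta_add_1 ring_distribs add_divide_distrib exp_add)
qed

text \<open>
  The three theta constants are the values of \<open>jtheta\<close> at the half periods \<open>0\<close>, \<open>1/2\<close> and \<open>\<tau>/2\<close> up to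
  an exponential factor, and inversion exchanges the last two half periods.
\<close>

lemma theta_const_inversion:
  assumes "Im \<tau> > 0"
  obtains c where "c \<noteq> 0"
    "theta_const 0 0 (- 1 / \<tau>) = c * theta_const 0 0 \<tau>"
    "theta_const 1 0 (- 1 / \<tau>) = c * theta_const 0 1 \<tau>"
    "theta_const 0 1 (- 1 / \<tau>) = c * theta_const 1 0 \<tau>"
proof -
  have [simp]: "\<tau> \<noteq> 0" using assms by force
  obtain c where c: "c \<noteq> 0"
    "\<And>z. exp (- of_real pi * \<i> * z\<^sup>2 / \<tau>) * jtheta (z / \<tau>) (- 1 / \<tau>) = c * jtheta z \<tau>"
    using jtheta_inversion[OF assms] by blast
  have "theta_const 0 0 (- 1 / \<tau>) = c * theta_const 0 0 \<tau>"
    using c(2)[of 0] by (simp add: theta_const_0_0)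
  moreover have "theta_const 1 0 (- 1 / \<tau>) = c * theta_const 0 1 \<tau>"
  proof -
    have "jtheta (- 1 / \<tau> / 2) (- 1 / \<tau>) = jtheta (1 / 2 / \<tau>) (- 1 / \<tau>)"
      using jtheta_minus[of "1 / 2 / \<tau>" "- 1 / \<tau>"] by (simp add: mult.commute)
    moreover have "of_real pi * \<i> * (- 1 / \<tau>) / 4 = - of_real pi * \<i> * (1 / 2)\<^sup>2 / \<tau>"
      by (simp add: power2_eq_square)
    ultimately show ?thesis
      using c(2)[of "1 / 2"] by (simp only: theta_const_1_0 theta_const_0_1)
  qed
  moreover have "theta_const 0 1 (- 1 / \<tau>) = c * theta_const 1 0 \<tau>"
  proof -
    have "exp (- of_real pi * \<i> * (\<tau> / 2)\<^sup>2 / \<tau>) = inverse (exp (of_real pi * \<i> * \<tau> / 4))"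
      unfolding exp_minus [symmetric]
      by (rule arg_cong[of _ _ exp]) (simp add: power2_eq_square)
    then have "inverse (exp (of_real pi * \<i> * \<tau> / 4)) * jtheta (1 / 2) (- 1 / \<tau>) = c * jtheta (\<tau> / 2) \<tau>"
      using c(2)[of "\<tau> / 2"] by simp
    then show ?thesis
      unfolding theta_const_1_0 theta_const_0_1 by (simp add: field_simps)
  qed
  ultimately show ?thesis using that c(1) by blast
qed

text \<open>
  The constant 3 comes from \<open>2 r / (1 - r) \<le> 3 r\<close> for \<open>r \<le> 1/3\<close>.
\<close>

lemma sum_int_tail_bound:
  fixes a :: "int \<Rightarrow> complex"
  assumes sum: "a summable_on UNIV" and "finite A" "0 \<in> A" and "0 \<le> r" "r \<le> 1 / 3"
    and bound: "\<And>n. n \<notin> A \<Longrightarrow> norm (a n) \<le> r ^ nat \<bar>n\<bar>"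
  shows "norm ((\<Sum>\<^sub>\<infinity>n. a n) - (\<Sum>n\<in>A. a n)) \<le> 3 * r"
proof -
  have "(a has_sum ((\<Sum>\<^sub>\<infinity>n. a n) - (\<Sum>n\<in>A. a n))) (UNIV - A)"
    using sum \<open>finite A\<close> by (intro has_sum_Diff) auto
  then have "((\<lambda>n. if n \<in> A then 0 else a n) has_sum ((\<Sum>\<^sub>\<infinity>n. a n) - (\<Sum>n\<in>A. a n))) (UNIV - {0})"
    by (rule has_sum_cong_neutral[THEN iffD1, rotated -1]) (use \<open>0 \<in> A\<close> in auto)
  moreover have "((\<lambda>n::int. r ^ nat \<bar>n\<bar>) has_sum (2 * r / (1 - r))) (UNIV - {0})"
    using assms by (intro has_sum_geometric_int) auto
  ultimately have "norm ((\<Sum>\<^sub>\<infinity>n. a n) - (\<Sum>n\<in>A. a n)) \<le> 2 * r / (1 - r)"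
    by (rule norm_infsum_le) (use bound \<open>0 \<le> r\<close> in auto)
  also have "\<dots> \<le> 3 * r"
  proof -
    have "2 * r \<le> 3 * r * (1 - r)"
      using assms mult_left_mono[of r "1/3" r] by (simp add: algebra_simps)
    then show ?thesis using assms by (simp add: divide_simps)
  qed
  finally show ?thesis .
qed

lemma nome_less_third:
  assumes "y \<ge> 1 / 2"
  shows "exp (- (pi * y)) < 1 / 3"
proof -
  have "3 / 2 \<le> pi * y"
    using mult_mono[of 3 pi "1 / 2" y] pi_gt3 assms by simp
  then have "1 + 3 / 2 + (3 / 2)\<^sup>2 / 2 \<le> 1 + pi * y + (pi * y)\<^sup>2 / 2"
    by (intro add_mono divide_right_mono power_mono) auto
  also have "\<dots> \<le> exp (pi * y)"
    using \<open>3 / 2 \<le> pi * y\<close> by (intro exp_lower_Taylor_quadratic) auto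
  finally have "3 < exp (pi * y)" by (simp add: power2_eq_square)
  then show ?thesis by (simp add: exp_minus field_simps)
qed

text \<open>
  Each theta series is within \<open>3 exp (- \<pi> Im \<tau>) < 1\<close> of the sum of those terms that do not decay.
  For real \<open>z\<close> this is the term of index 0, for \<open>z = \<tau>/2\<close> those of index 0 and -1.
\<close>

lemma jtheta_bounds:
  assumes "Im \<tau> \<ge> 1 / 2"
  shows jtheta_real_bound: "norm (jtheta (of_real x) \<tau> - 1) \<le> 3 * exp (- (pi * Im \<tau>))"
    and jtheta_half_tau_bound: "norm (jtheta (\<tau> / 2) \<tau> - 2) \<le> 3 * exp (- (pi * Im \<tau>))"
proof -
  define r where "r = exp (- (pi * Im \<tau>))"
  have r: "0 \<le> r" "r \<le> 1 / 3" using nome_less_third[OF assms] by (auto simp: r_def)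
  have pow: "exp (- (pi * Im \<tau>) * k) \<le> r ^ nat \<bar>n\<bar>" if "\<bar>n\<bar> \<le> k" for n k :: int
  proof -
    have "exp (- (pi * Im \<tau>) * k) = r ^ nat k"
      using that by (simp add: r_def exp_of_nat_mult [symmetric] mult_ac)
    also have "\<dots> \<le> r ^ nat \<bar>n\<bar>" using r that by (intro power_decreasing) auto
    finally show ?thesis .
  qed
  have "norm (jtheta (of_real x) \<tau> -
      (\<Sum>n\<in>{0}. exp (of_real pi * \<i> * ((of_int n)\<^sup>2 * \<tau> + 2 * of_int n * of_real x)))) \<le> 3 * r"
    unfolding jtheta_def
  proof (rule sum_int_tail_bound)
    fix n :: int
    have "norm (exp (of_real pi * \<i> * ((of_int n)\<^sup>2 * \<tau> + 2 * of_int n * of_real x))) =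
        exp (- (pi * Im \<tau>) * (n * n))"
      by (simp add: power2_eq_square mult_ac)
    also have "\<dots> \<le> r ^ nat \<bar>n\<bar>"
    proof (rule pow)
      have "\<bar>n\<bar> * 1 \<le> \<bar>n\<bar> * \<bar>n\<bar>" by (cases "n = 0") (simp, intro mult_left_mono, auto)
      then show "\<bar>n\<bar> \<le> n * n" by (simp add: abs_mult_self_eq)
    qed
    finally show "norm (exp (of_real pi * \<i> * ((of_int n)\<^sup>2 * \<tau> + 2 * of_int n * of_real x))) \<le> r ^ nat \<bar>n\<bar>" .
  qed (use assms r in \<open>auto intro!: theta_summable\<close>)
  then show "norm (jtheta (of_real x) \<tau> - 1) \<le> 3 * exp (- (pi * Im \<tau>))" by (simp add: r_def)
  have "norm (jtheta (\<tau> / 2) \<tau> -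
      (\<Sum>n\<in>{0,-1}. exp (of_real pi * \<i> * ((of_int n)\<^sup>2 * \<tau> + 2 * of_int n * (\<tau> / 2))))) \<le> 3 * r"
    unfolding jtheta_def
  proof (rule sum_int_tail_bound)
    fix n :: int assume n: "n \<notin> {0, -1}"
    have "norm (exp (of_real pi * \<i> * ((of_int n)\<^sup>2 * \<tau> + 2 * of_int n * (\<tau> / 2)))) =
        exp (- (pi * Im \<tau>) * (n * (n + 1)))"
      by (simp add: power2_eq_square algebra_simps)
    also have "\<dots> \<le> r ^ nat \<bar>n\<bar>"
    proof (rule pow)
      show "\<bar>n\<bar> \<le> n * (n + 1)"
      proof (cases "n > 0")
        case True
        then show ?thesis using mult_left_mono[of 1 "n + 1" n] by simp
      next
        case False
        then show ?thesis using n mult_left_mono[of 1 "- (n + 1)" "- n"] by (simp add: algebra_simps)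
      qed
    qed
    finally show "norm (exp (of_real pi * \<i> * ((of_int n)\<^sup>2 * \<tau> + 2 * of_int n * (\<tau> / 2)))) \<le> r ^ nat \<bar>n\<bar>" .
  next
    show "(\<lambda>n::int. exp (of_real pi * \<i> * ((of_int n)\<^sup>2 * \<tau> + 2 * of_int n * (\<tau> / 2)))) summable_on UNIV"
      using assms by (intro theta_summable) simp
  qed (use r in auto)
  then show "norm (jtheta (\<tau> / 2) \<tau> - 2) \<le> 3 * exp (- (pi * Im \<tau>))" by (simp add: r_def)
qed

section \<open>Reduction theory of the modular group\<close>

text \<open>
  Reduction theory for the modular group in the form of an induction principle. After an integer
  translation \<open>|Re \<tau>| \<le> 1/2\<close>; if then \<open>Im \<tau> < 1/2\<close>, the inversion \<open>\<tau> \<mapsto> -1/\<tau>\<close> at least doubles the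
  imaginary part, so finitely many steps lead to \<open>Im \<tau> \<ge> 1/2\<close>.
\<close>

lemma modular_induct:
  assumes "Im \<tau> > 0" and base: "\<And>\<tau>. Im \<tau> \<ge> 1 / 2 \<Longrightarrow> P \<tau>"
    and T: "\<And>\<tau>. Im \<tau> > 0 \<Longrightarrow> P (\<tau> + 1) = P \<tau>" and S: "\<And>\<tau>. Im \<tau> > 0 \<Longrightarrow> P (- 1 / \<tau>) \<Longrightarrow> P \<tau>"
  shows "P \<tau>"
proof -
  have shift: "P (\<tau> + of_int k) = P \<tau>" if "Im \<tau> > 0" for \<tau> k
    using periodic_of_int[of "{\<tau>. Im \<tau> > 0}" P \<tau> k] T that by simp
  have main: "P \<tau>" if "Im \<tau> > 0" "1 / 2 \<le> Im \<tau> * 2 ^ n" for \<tau> n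
    using that
  proof (induction n arbitrary: \<tau>)
    case 0
    then show ?case using base by simp
  next
    case (Suc n)
    show ?case
    proof (cases "Im \<tau> \<ge> 1 / 2")
      case True
      then show ?thesis by (rule base)
    next
      case False
      define \<sigma> where "\<sigma> = \<tau> + of_int (- round (Re \<tau>))"
      have im: "Im \<sigma> = Im \<tau>" by (simp add: \<sigma>_def)
      have "\<bar>Re \<sigma>\<bar> \<le> 1 / 2"
        using of_int_round_abs_le[of "Re \<tau>"] by (simp add: \<sigma>_def abs_minus_commute)
      then have "(Re \<sigma>)\<^sup>2 \<le> (1 / 2)\<^sup>2" by (simp add: abs_le_square_iff [symmetric])
      moreover have "(Im \<sigma>)\<^sup>2 \<le> (1 / 2)\<^sup>2" using False Suc.prems im by (intro power_mono) auto
      ultimately have small: "(Re \<sigma>)\<^sup>2 + (Im \<sigma>)\<^sup>2 \<le> 1 / 2" by (simp add: power2_eq_square)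
      have pos: "(Re \<sigma>)\<^sup>2 + (Im \<sigma>)\<^sup>2 > 0"
        using Suc.prems im by (intro add_nonneg_pos) auto
      have "Im (- 1 / \<sigma>) = Im \<sigma> / ((Re \<sigma>)\<^sup>2 + (Im \<sigma>)\<^sup>2)"
        by (simp add: Im_divide)
      moreover have "2 * Im \<sigma> \<le> Im \<sigma> / ((Re \<sigma>)\<^sup>2 + (Im \<sigma>)\<^sup>2)"
      proof -
        have "Im \<sigma> * ((Re \<sigma>)\<^sup>2 + (Im \<sigma>)\<^sup>2) \<le> Im \<sigma> * (1 / 2)"
          using small Suc.prems im by (intro mult_left_mono) auto
        then show ?thesis using pos by (simp add: pos_le_divide_eq mult_ac)
      qed
      ultimately have double: "2 * Im \<sigma> \<le> Im (- 1 / \<sigma>)" by simp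
      have "P (- 1 / \<sigma>)"
      proof (rule Suc.IH)
        show "Im (- 1 / \<sigma>) > 0" using double Suc.prems im by linarith
        have "1 / 2 \<le> 2 * Im \<sigma> * 2 ^ n" using Suc.prems im by (simp add: mult_ac)
        also have "\<dots> \<le> Im (- 1 / \<sigma>) * 2 ^ n" using double by (intro mult_right_mono) auto
        finally show "1 / 2 \<le> Im (- 1 / \<sigma>) * 2 ^ n" .
      qed
      then have "P \<sigma>" using S Suc.prems im by simp
      then show ?thesis using shift[of \<tau> "- round (Re \<tau>)"] Suc.prems by (simp add: \<sigma>_def)
    qed
  qed
  obtain n where "1 / 2 / Im \<tau> < 2 ^ n"
    using real_arch_pow[of 2 "1 / 2 / Im \<tau>"] by auto
  then have "1 / 2 \<le> Im \<tau> * 2 ^ n"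
    using assms(1) by (simp add: pos_divide_less_eq mult_ac)
  with assms(1) show ?thesis by (rule main)
qed

text \<open>
  In the region \<open>Im \<tau> \<ge> 1/2\<close> the leading terms dominate. Translation and inversion permute the three
  constants up to non-zero factors, which carries the statement to the whole half-plane.
\<close>

lemma theta_const_nonzero:
  assumes "Im \<tau> > 0"
  shows "theta_const 0 0 \<tau> \<noteq> 0 \<and> theta_const 0 1 \<tau> \<noteq> 0 \<and> theta_const 1 0 \<tau> \<noteq> 0"
  using assms
proof (rule modular_induct)
  fix \<tau> :: complex assume "Im \<tau> \<ge> 1 / 2"
  note b = jtheta_bounds[OF this] nome_less_third[OF this]
  show "theta_const 0 0 \<tau> \<noteq> 0 \<and> theta_const 0 1 \<tau> \<noteq> 0 \<and> theta_const 1 0 \<tau> \<noteq> 0"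
    using b(1)[of 0] b(1)[of "1 / 2"] b(2,3)
    by (auto simp: theta_const_0_0 theta_const_0_1 theta_const_1_0)
next
  fix \<tau> :: complex assume "Im \<tau> > 0"
    and nz: "theta_const 0 0 (- 1 / \<tau>) \<noteq> 0 \<and> theta_const 0 1 (- 1 / \<tau>) \<noteq> 0 \<and> theta_const 1 0 (- 1 / \<tau>) \<noteq> 0"
  from theta_const_inversion[OF this(1)] nz
  show "theta_const 0 0 \<tau> \<noteq> 0 \<and> theta_const 0 1 \<tau> \<noteq> 0 \<and> theta_const 1 0 \<tau> \<noteq> 0"
    by (metis mult_zero_right)
qed (auto simp: theta_const_add_1)

text \<open>
  An invariant function that tends to 0 at the cusp attains its maximal modulus: outside a
  compact part of the strip \<open>|Re \<tau>| \<le> 1/2\<close>, \<open>Im \<tau> \<ge> 1/2\<close> it is small, and every orbit meets this strip.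
  By the maximum modulus principle it is constant, hence 0. The filter \<open>filtercomap Im at_top\<close>
  expresses \<open>Im \<tau> \<rightarrow> \<infinity>\<close>, uniformly in \<open>Re \<tau>\<close>.
\<close>

lemma invariant_vanishing:
  assumes holo: "f holomorphic_on {\<tau>. Im \<tau> > 0}"
    and T: "\<And>\<tau>. Im \<tau> > 0 \<Longrightarrow> f (\<tau> + 1) = f \<tau>" and S: "\<And>\<tau>. Im \<tau> > 0 \<Longrightarrow> f (- 1 / \<tau>) = f \<tau>"
    and lim: "(f \<longlongrightarrow> 0) (filtercomap Im at_top)"
    and "Im \<tau>\<^sub>1 > 0"
  shows "f \<tau>\<^sub>1 = 0"
proof (rule ccontr)
  assume nz: "f \<tau>\<^sub>1 \<noteq> 0"
  define m where "m = norm (f \<tau>\<^sub>1)"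
  have "\<forall>\<^sub>F \<tau> in filtercomap Im at_top. norm (f \<tau>) < m"
    using tendstoD[OF lim, of m] nz by (simp add: m_def)
  then obtain Y0 where "\<And>\<tau>. Im \<tau> \<ge> Y0 \<Longrightarrow> norm (f \<tau>) < m"
    by (auto simp: eventually_filtercomap_at_top_linorder)
  then obtain Y where Y: "Y \<ge> 1" "\<And>\<tau>. Im \<tau> \<ge> Y \<Longrightarrow> norm (f \<tau>) < m"
    by (meson dual_order.trans max.cobounded1 max.cobounded2)
  define K where "K = cbox (Complex (- 1 / 2) (1 / 2)) (Complex (1 / 2) Y)"
  have inK: "\<tau> \<in> K \<longleftrightarrow> \<bar>Re \<tau>\<bar> \<le> 1 / 2 \<and> 1 / 2 \<le> Im \<tau> \<and> Im \<tau> \<le> Y" for \<tau>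
    by (auto simp: K_def in_cbox_complex_iff)
  have "\<exists>\<tau>\<^sub>0\<in>K. \<forall>\<tau>\<in>K. norm (f \<tau>) \<le> norm (f \<tau>\<^sub>0)"
  proof (rule continuous_attains_sup)
    have "\<i> \<in> K" using Y by (simp add: inK)
    then show "K \<noteq> {}" by blast
    have "f holomorphic_on K" by (rule holomorphic_on_subset[OF holo]) (auto simp: inK)
    then show "continuous_on K (\<lambda>\<tau>. norm (f \<tau>))"
      by (intro continuous_on_norm holomorphic_on_imp_continuous_on)
  qed (simp add: K_def)
  then obtain \<tau>\<^sub>0 where \<tau>0: "\<tau>\<^sub>0 \<in> K" "\<And>\<tau>. \<tau> \<in> K \<Longrightarrow> norm (f \<tau>) \<le> norm (f \<tau>\<^sub>0)" by blast
  have bound: "norm (f \<tau>) < m \<or> norm (f \<tau>) \<le> norm (f \<tau>\<^sub>0)" if "Im \<tau> > 0" for \<tau>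
    using that
  proof (rule modular_induct)
    fix \<tau> :: complex assume im: "Im \<tau> \<ge> 1 / 2"
    define \<sigma> where "\<sigma> = \<tau> + of_int (- round (Re \<tau>))"
    have "f \<sigma> = f \<tau>"
      using periodic_of_int[of "{\<tau>. Im \<tau> > 0}" f \<tau> "- round (Re \<tau>)"] T im by (simp add: \<sigma>_def)
    moreover have "\<bar>Re \<sigma>\<bar> \<le> 1 / 2"
      using of_int_round_abs_le[of "Re \<tau>"] by (simp add: \<sigma>_def abs_minus_commute)
    then have "\<sigma> \<in> K \<or> Im \<sigma> \<ge> Y" using im by (auto simp: inK \<sigma>_def)
    then have "norm (f \<sigma>) < m \<or> norm (f \<sigma>) \<le> norm (f \<tau>\<^sub>0)" using Y(2) \<tau>0(2) by blast
    ultimately show "norm (f \<tau>) < m \<or> norm (f \<tau>) \<le> norm (f \<tau>\<^sub>0)" by simp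
  next
    fix \<tau> :: complex assume "Im \<tau> > 0" "norm (f (- 1 / \<tau>)) < m \<or> norm (f (- 1 / \<tau>)) \<le> norm (f \<tau>\<^sub>0)"
    then show "norm (f \<tau>) < m \<or> norm (f \<tau>) \<le> norm (f \<tau>\<^sub>0)" by (simp only: S)
  qed (simp add: T)
  from bound[OF \<open>Im \<tau>\<^sub>1 > 0\<close>] have "m \<le> norm (f \<tau>\<^sub>0)" by (simp add: m_def)
  have "f constant_on {\<tau>. Im \<tau> > 0}"
  proof (rule maximum_modulus_principle[OF holo])
    show "norm (f \<tau>) \<le> norm (f \<tau>\<^sub>0)" if "\<tau> \<in> {\<tau>. Im \<tau> > 0}" for \<tau>
      using bound[of \<tau>] that \<open>m \<le> norm (f \<tau>\<^sub>0)\<close> by auto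
    show "\<tau>\<^sub>0 \<in> {\<tau>. Im \<tau> > 0}" using \<tau>0(1) by (simp add: inK)
  qed (auto intro: open_halfspace_Im_gt convex_connected convex_halfspace_Im_gt)
  then have "f (\<i> * of_real Y) = f \<tau>\<^sub>1"
    using Y(1) \<open>Im \<tau>\<^sub>1 > 0\<close> by (auto simp: constant_on_def)
  then show False using Y(2)[of "\<i> * of_real Y"] by (simp add: m_def)
qed

section \<open>Jacobi's identity\<close>

lemma tendsto_nome: "((\<lambda>\<tau>. exp (of_real pi * \<i> * \<tau>)) \<longlongrightarrow> 0) (filtercomap Im at_top)"
proof -
  have "filterlim (\<lambda>y. pi * y) at_top at_top"
    by (rule filterlim_tendsto_pos_mult_at_top[OF tendsto_const _ filterlim_ident]) simp
  then have "filterlim (\<lambda>y. - (pi * y)) at_bot at_top"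
    by (simp only: filterlim_uminus_at_top)
  then have "((\<lambda>y. exp (- (pi * y))) \<longlongrightarrow> 0) at_top"
    by (rule filterlim_compose[OF exp_at_bot])
  then have "((\<lambda>\<tau>. exp (- (pi * Im \<tau>))) \<longlongrightarrow> 0) (filtercomap Im at_top)"
    by (rule filterlim_compose[OF _ filterlim_filtercomap])
  then show ?thesis by (subst tendsto_norm_zero_iff [symmetric]) simp
qed

lemma norm_nome: "norm (exp (of_real pi * \<i> * \<tau>)) = exp (- (pi * Im \<tau>))"
  by simp

lemma eventually_Im_ge: "\<forall>\<^sub>F \<tau> in filtercomap Im at_top. Im \<tau> \<ge> (c :: real)"
  unfolding eventually_filtercomap_at_top_linorder by blast

lemma theta_const_limits:
  "((\<lambda>\<tau>. jtheta (of_real x) \<tau>) \<longlongrightarrow> 1) (filtercomap Im at_top)"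
  "((\<lambda>\<tau>. jtheta (\<tau> / 2) \<tau>) \<longlongrightarrow> 2) (filtercomap Im at_top)"
proof -
  have "((\<lambda>\<tau>. 3 * norm (exp (of_real pi * \<i> * \<tau>))) \<longlongrightarrow> 3 * norm (0 :: complex)) (filtercomap Im at_top)"
    by (rule tendsto_mult_left[OF tendsto_norm[OF tendsto_nome]])
  then have r: "((\<lambda>\<tau>. 3 * exp (- (pi * Im \<tau>))) \<longlongrightarrow> 0) (filtercomap Im at_top)"
    by (simp add: norm_nome)
  show "((\<lambda>\<tau>. jtheta (of_real x) \<tau>) \<longlongrightarrow> 1) (filtercomap Im at_top)"
    by (rule LIM_zero_cancel, rule Lim_null_comparison[OF eventually_mono[OF eventually_Im_ge[of "1/2"]] r],
        rule jtheta_real_bound)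
  show "((\<lambda>\<tau>. jtheta (\<tau> / 2) \<tau>) \<longlongrightarrow> 2) (filtercomap Im at_top)"
    by (rule LIM_zero_cancel, rule Lim_null_comparison[OF eventually_mono[OF eventually_Im_ge[of "1/2"]] r],
        rule jtheta_half_tau_bound)
qed

lemma theta_const_1_0_power4: "theta_const 1 0 \<tau> ^ 4 = exp (of_real pi * \<i> * \<tau>) * jtheta (\<tau> / 2) \<tau> ^ 4"
  by (simp add: theta_const_1_0 power_mult_distrib exp_of_nat_mult [symmetric])

text \<open>
  Let \<open>b\<close> be the difference of the two sides. Translation and inversion act on \<open>b\<close> and on the product
  of the three theta constants by scalars that cancel in \<open>E = b^6 / (\<theta>\<^sub>2 \<theta>\<^sub>3 \<theta>\<^sub>4)^8\<close>. With
  \<open>w = exp (\<pi> i \<tau>)\<close>, one has \<open>b = O(w)\<close> while the denominator is of exact order \<open>w\<^sup>2\<close>, so \<open>E\<close> vanishes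
  at the cusp and therefore everywhere.
\<close>

lemma jacobi_identity:
  assumes "Im \<tau> > 0"
  shows "theta_const 0 0 \<tau> ^ 4 = theta_const 1 0 \<tau> ^ 4 + theta_const 0 1 \<tau> ^ 4"
proof -
  let ?t2 = "theta_const 1 0" and ?t3 = "theta_const 0 0" and ?t4 = "theta_const 0 1"
  define b where "b \<tau> = ?t2 \<tau> ^ 4 + ?t4 \<tau> ^ 4 - ?t3 \<tau> ^ 4" for \<tau>
  define E where "E \<tau> = b \<tau> ^ 6 / (?t2 \<tau> * ?t3 \<tau> * ?t4 \<tau>) ^ 8" for \<tau>
  have "E \<tau> = 0"
  proof (rule invariant_vanishing[OF _ _ _ _ assms])
    show "E holomorphic_on {\<tau>. Im \<tau> > 0}"
      unfolding E_def b_def using theta_const_nonzero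
      by (intro holomorphic_intros theta_const_holomorphic) auto
    have \<zeta>: "exp (of_real pi * \<i> / 4) ^ 4 = (-1 :: complex)"
      by (simp add: exp_of_nat_mult [symmetric])
    then have \<zeta>8: "exp (of_real pi * \<i> / 4) ^ 8 = (1 :: complex)"
      using power_mult[of "exp (of_real pi * \<i> / 4) :: complex" 4 2] by simp
    show "E (\<tau> + 1) = E \<tau>" if "Im \<tau> > 0" for \<tau>
    proof -
      have "b (\<tau> + 1) = - b \<tau>"
        by (simp add: b_def theta_const_add_1 power_mult_distrib \<zeta>)
      moreover have "(?t2 (\<tau> + 1) * ?t3 (\<tau> + 1) * ?t4 (\<tau> + 1)) ^ 8 = (?t2 \<tau> * ?t3 \<tau> * ?t4 \<tau>) ^ 8"
        by (simp add: theta_const_add_1 power_mult_distrib \<zeta>8)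
      ultimately show ?thesis by (simp add: E_def)
    qed
    show "E (- 1 / \<tau>) = E \<tau>" if im: "Im \<tau> > 0" for \<tau>
    proof -
      obtain c where c: "c \<noteq> 0" "?t3 (- 1 / \<tau>) = c * ?t3 \<tau>" "?t2 (- 1 / \<tau>) = c * ?t4 \<tau>" "?t4 (- 1 / \<tau>) = c * ?t2 \<tau>"
        using theta_const_inversion[OF im] by metis
      have "b (- 1 / \<tau>) = c ^ 4 * b \<tau>"
        unfolding b_def c(2-4) by (simp add: power_mult_distrib algebra_simps)
      moreover have "?t2 (- 1 / \<tau>) * ?t3 (- 1 / \<tau>) * ?t4 (- 1 / \<tau>) = c ^ 3 * (?t2 \<tau> * ?t3 \<tau> * ?t4 \<tau>)"
        unfolding c(2-4) by (simp add: power3_eq_cube mult_ac)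
      ultimately have "E (- 1 / \<tau>) = (c ^ 4 * b \<tau>) ^ 6 / (c ^ 3 * (?t2 \<tau> * ?t3 \<tau> * ?t4 \<tau>)) ^ 8"
        by (simp only: E_def)
      also have "\<dots> = (c ^ 24 * b \<tau> ^ 6) / (c ^ 24 * (?t2 \<tau> * ?t3 \<tau> * ?t4 \<tau>) ^ 8)"
        by (simp only: power_mult_distrib power_mult [symmetric]) simp
      also have "\<dots> = E \<tau>"
        using c(1) by (simp add: E_def)
      finally show ?thesis .
    qed
    show "(E \<longlongrightarrow> 0) (filtercomap Im at_top)"
    proof -
      define w where "w \<tau> = exp (of_real pi * \<i> * \<tau>)" for \<tau>
      define u where "u \<tau> = jtheta (\<tau> / 2) \<tau>" for \<tau>
      define S where "S \<tau> = ?t4 \<tau> ^ 3 + ?t4 \<tau> ^ 2 * ?t3 \<tau> + ?t4 \<tau> * ?t3 \<tau> ^ 2 + ?t3 \<tau> ^ 3" for \<tau>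
      have t3: "(?t3 \<longlongrightarrow> 1) (filtercomap Im at_top)" and t4: "(?t4 \<longlongrightarrow> 1) (filtercomap Im at_top)"
        using theta_const_limits(1)[of 0] theta_const_limits(1)[of "1/2"]
        by (simp_all add: theta_const_0_0[abs_def] theta_const_0_1[abs_def])
      have u: "(u \<longlongrightarrow> 2) (filtercomap Im at_top)"
        unfolding u_def by (rule theta_const_limits)
      have w: "(w \<longlongrightarrow> 0) (filtercomap Im at_top)"
        unfolding w_def by (rule tendsto_nome)
      have t2: "?t2 \<tau> ^ 4 = w \<tau> * u \<tau> ^ 4" for \<tau>
        by (simp add: theta_const_1_0_power4 w_def u_def)
      have b0: "(b \<longlongrightarrow> 0 * 2 ^ 4 + 1 ^ 4 - 1 ^ 4) (filtercomap Im at_top)"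
        unfolding b_def t2 by (intro tendsto_intros u w t3 t4)
      have S: "(S \<longlongrightarrow> 1 ^ 3 + 1 ^ 2 * 1 + 1 * 1 ^ 2 + 1 ^ 3) (filtercomap Im at_top)"
        unfolding S_def by (intro tendsto_intros t3 t4)
      then have "\<forall>\<^sub>F \<tau> in filtercomap Im at_top. norm (S \<tau>) < 5"
        by (intro order_tendstoD(2)[OF tendsto_norm]) auto
      moreover have "\<forall>\<^sub>F \<tau> in filtercomap Im at_top. norm (u \<tau> ^ 4) < 17"
        by (intro order_tendstoD(2)[OF tendsto_norm[OF tendsto_power[OF u]]]) auto
      \<comment> \<open>\<open>b / w\<close> stays bounded; the limits 16 of \<open>u ^ 4\<close> and 4 of \<open>S\<close> give \<open>17 + 6 * 5 = 47\<close>\<close>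
      ultimately have X: "\<forall>\<^sub>F \<tau> in filtercomap Im at_top. norm (b \<tau> / w \<tau>) \<le> 47"
        using eventually_Im_ge[of "1/2"]
      proof eventually_elim
        case (elim \<tau>)
        have eq: "b \<tau> / w \<tau> = u \<tau> ^ 4 + (?t4 \<tau> - ?t3 \<tau>) / w \<tau> * S \<tau>"
        proof -
          have "?t4 \<tau> ^ 4 - ?t3 \<tau> ^ 4 = (?t4 \<tau> - ?t3 \<tau>) * S \<tau>"
            by (simp add: S_def algebra_simps power2_eq_square power3_eq_cube power4_eq_xxxx)
          then have "b \<tau> = w \<tau> * u \<tau> ^ 4 + (?t4 \<tau> - ?t3 \<tau>) * S \<tau>"
            by (simp add: b_def t2)
          then show ?thesis by (simp add: w_def add_divide_distrib)
        qed
        have "norm ((?t4 \<tau> - ?t3 \<tau>) / w \<tau>) \<le> 6"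
        proof -
          have "norm (?t4 \<tau> - ?t3 \<tau>) \<le> norm (?t4 \<tau> - 1) + norm (?t3 \<tau> - 1)"
            by (metis norm_triangle_ineq4 diff_diff_eq2 diff_add_cancel add_diff_cancel)
          also have "\<dots> \<le> 6 * norm (w \<tau>)"
            using jtheta_real_bound[OF elim(3), of 0] jtheta_real_bound[OF elim(3), of "1/2"]
            by (simp add: theta_const_0_0 theta_const_0_1 w_def)
          finally show ?thesis by (simp add: norm_divide w_def divide_le_eq)
        qed
        then have "norm ((?t4 \<tau> - ?t3 \<tau>) / w \<tau> * S \<tau>) \<le> 6 * 5"
          unfolding norm_mult using elim by (intro mult_mono) auto
        then show ?case
          unfolding eq using elim norm_triangle_ineq[of "u \<tau> ^ 4" "(?t4 \<tau> - ?t3 \<tau>) / w \<tau> * S \<tau>"] by linarith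
      qed
      have "((\<lambda>\<tau>. norm (b \<tau> ^ 4) * 47\<^sup>2) \<longlongrightarrow> norm ((0::complex) ^ 4) * 47\<^sup>2) (filtercomap Im at_top)"
        using b0 by (intro tendsto_intros) simp
      then have lim0: "((\<lambda>\<tau>. norm (b \<tau> ^ 4) * 47\<^sup>2) \<longlongrightarrow> 0) (filtercomap Im at_top)"
        by simp
      have "((\<lambda>\<tau>. b \<tau> ^ 4 * (b \<tau> / w \<tau>)\<^sup>2) \<longlongrightarrow> 0) (filtercomap Im at_top)"
      proof (rule Lim_null_comparison[OF _ lim0])
        show "\<forall>\<^sub>F \<tau> in filtercomap Im at_top. norm (b \<tau> ^ 4 * (b \<tau> / w \<tau>)\<^sup>2) \<le> norm (b \<tau> ^ 4) * 47\<^sup>2"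
          using X
        proof eventually_elim
          case (elim \<tau>)
          then have "norm (b \<tau> / w \<tau>) ^ 2 \<le> 47\<^sup>2" by (intro power_mono) auto
          then show ?case unfolding norm_mult norm_power[of "b \<tau> / w \<tau>"] by (intro mult_left_mono) auto
        qed
      qed
      then have "((\<lambda>\<tau>. b \<tau> ^ 4 * (b \<tau> / w \<tau>)\<^sup>2 / ((u \<tau> ^ 4)\<^sup>2 * ?t3 \<tau> ^ 8 * ?t4 \<tau> ^ 8)) \<longlongrightarrow>
          0 / ((2 ^ 4)\<^sup>2 * 1 ^ 8 * 1 ^ 8)) (filtercomap Im at_top)"
        by (intro tendsto_intros u t3 t4) auto
      moreover have "b \<tau> ^ 4 * (b \<tau> / w \<tau>)\<^sup>2 / ((u \<tau> ^ 4)\<^sup>2 * ?t3 \<tau> ^ 8 * ?t4 \<tau> ^ 8) = E \<tau>" for \<tau>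
      proof -
        have "?t2 \<tau> ^ 8 = (w \<tau> * u \<tau> ^ 4)\<^sup>2"
          unfolding t2 [symmetric] by (simp add: power_mult [symmetric])
        then show ?thesis
          by (simp add: E_def power_mult_distrib power_divide mult_ac flip: power_add)
      qed
      ultimately show ?thesis by simp
    qed
  qed
  then have "b \<tau> = 0" using theta_const_nonzero[OF assms] by (simp add: E_def)
  then show ?thesis by (simp add: b_def)
qed

section \<open>Modular behaviour of \<open>\<lambda>\<close> and the invariant of the full modular group\<close>

lemma one_minus_modular_lambda:
  assumes "Im \<tau> > 0"
  shows "1 - modular_lambda \<tau> = theta_const 0 1 \<tau> ^ 4 / theta_const 0 0 \<tau> ^ 4"
proof -
  have "theta_const 0 1 \<tau> ^ 4 = theta_const 0 0 \<tau> ^ 4 - theta_const 1 0 \<tau> ^ 4"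
    using jacobi_identity[OF assms] by simp
  then show ?thesis
    using theta_const_nonzero[OF assms] by (simp add: modular_lambda_def diff_divide_distrib)
qed

lemma modular_lambda_holomorphic: "modular_lambda holomorphic_on {\<tau>. Im \<tau> > 0}"
  unfolding modular_lambda_def using theta_const_nonzero
  by (intro holomorphic_intros theta_const_holomorphic) auto

lemma modular_lambda_ne:
  assumes "Im \<tau> > 0"
  shows "modular_lambda \<tau> \<noteq> 0" "1 - modular_lambda \<tau> \<noteq> 0"
  using theta_const_nonzero[OF assms] one_minus_modular_lambda[OF assms]
  by (simp_all add: modular_lambda_def)

lemma modular_lambda_add_1:
  assumes "Im \<tau> > 0"
  shows "modular_lambda (\<tau> + 1) = - modular_lambda \<tau> / (1 - modular_lambda \<tau>)"
proof -
  have \<zeta>: "exp (of_real pi * \<i> / 4) ^ 4 = (-1 :: complex)"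
    by (simp add: exp_of_nat_mult [symmetric])
  then show ?thesis
    using theta_const_nonzero[OF assms]
    unfolding one_minus_modular_lambda[OF assms]
    by (simp add: modular_lambda_def theta_const_add_1 power_mult_distrib)
qed

lemma modular_lambda_inversion:
  assumes "Im \<tau> > 0"
  shows "modular_lambda (- 1 / \<tau>) = 1 - modular_lambda \<tau>"
proof -
  obtain c where "c \<noteq> 0" "theta_const 0 0 (- 1 / \<tau>) = c * theta_const 0 0 \<tau>"
      "theta_const 1 0 (- 1 / \<tau>) = c * theta_const 0 1 \<tau>"
    using theta_const_inversion[OF assms] by metis
  then show ?thesis
    unfolding one_minus_modular_lambda[OF assms]
    by (simp add: modular_lambda_def power_mult_distrib)
qed

lemma modular_lambda_limit:
  "((\<lambda>\<tau>. modular_lambda \<tau> / exp (of_real pi * \<i> * \<tau>)) \<longlongrightarrow> 16) (filtercomap Im at_top)"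
proof -
  have "((\<lambda>\<tau>. jtheta (\<tau> / 2) \<tau> ^ 4 / theta_const 0 0 \<tau> ^ 4) \<longlongrightarrow> 2 ^ 4 / 1 ^ 4) (filtercomap Im at_top)"
    using theta_const_limits(1)[of 0] by (intro tendsto_intros theta_const_limits) (auto simp: theta_const_0_0)
  moreover have "jtheta (\<tau> / 2) \<tau> ^ 4 / theta_const 0 0 \<tau> ^ 4 = modular_lambda \<tau> / exp (of_real pi * \<i> * \<tau>)" for \<tau>
    by (simp add: modular_lambda_def theta_const_1_0_power4)
  ultimately show ?thesis by simp
qed

text \<open>
  Up to a factor 256 this is Klein's \<open>j\<close>: the simplest rational function of \<open>\<lambda>\<close> that is unchanged under
  the six substitutions generated by \<open>\<lambda> \<mapsto> 1 - \<lambda>\<close> and \<open>\<lambda> \<mapsto> \<lambda> / (\<lambda> - 1)\<close>.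
\<close>

definition jinv :: "complex \<Rightarrow> complex" where
  "jinv \<tau> = ((modular_lambda \<tau>)\<^sup>2 - modular_lambda \<tau> + 1) ^ 3 / ((modular_lambda \<tau>)\<^sup>2 * (1 - modular_lambda \<tau>)\<^sup>2)"

lemma jinv_holomorphic: "jinv holomorphic_on {\<tau>. Im \<tau> > 0}"
  unfolding jinv_def using modular_lambda_ne
  by (intro holomorphic_intros modular_lambda_holomorphic) auto

lemma jinv_add_1:
  assumes "Im \<tau> > 0"
  shows "jinv (\<tau> + 1) = jinv \<tau>"
proof -
  have cancel: "x / (a * c) / (b / c) = x / (b * a)" if "c \<noteq> 0" for a b c x :: complex
    using that by (simp add: mult.commute)
  define m where "m = 1 - modular_lambda \<tau>"
  have l: "modular_lambda \<tau> = 1 - m" and m: "m \<noteq> 0" "1 - m \<noteq> 0"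
    using modular_lambda_ne[OF assms] by (auto simp: m_def)
  have "(- (1 - m) / m)\<^sup>2 - - (1 - m) / m + 1 = (m\<^sup>2 - m + 1) / m\<^sup>2"
    using m by (simp add: divide_simps power2_eq_square) (simp add: algebra_simps)
  moreover have "1 - - (1 - m) / m = 1 / m"
    using m by (simp add: divide_simps)
  moreover have "(1 - m)\<^sup>2 - (1 - m) + 1 = m\<^sup>2 - m + 1"
    by (simp add: power2_eq_square algebra_simps)
  moreover have "1 - (1 - m) = m" by simp
  moreover have "(N / m\<^sup>2) ^ 3 / ((- n / m)\<^sup>2 * (1 / m)\<^sup>2) = N ^ 3 / (n\<^sup>2 * m\<^sup>2)" for N n
  proof -
    have "(N / m\<^sup>2) ^ 3 / ((- n / m)\<^sup>2 * (1 / m)\<^sup>2) = (N ^ 3 / (m\<^sup>2 * m ^ 4)) / (n\<^sup>2 / m ^ 4)"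
      by (simp add: power_divide flip: power_mult power_add)
    also have "\<dots> = N ^ 3 / (n\<^sup>2 * m\<^sup>2)"
      by (rule cancel) (use m in simp)
    finally show ?thesis .
  qed
  ultimately show ?thesis
    unfolding jinv_def modular_lambda_add_1[OF assms] l by (simp only:)
qed

lemma jinv_inversion:
  assumes "Im \<tau> > 0"
  shows "jinv (- 1 / \<tau>) = jinv \<tau>"
proof -
  have "(1 - modular_lambda \<tau>)\<^sup>2 - (1 - modular_lambda \<tau>) + 1 = (modular_lambda \<tau>)\<^sup>2 - modular_lambda \<tau> + 1"
    by (simp add: power2_eq_square algebra_simps)
  then show ?thesis
    unfolding jinv_def modular_lambda_inversion[OF assms] by (simp only:) (simp add: mult.commute)
qed

lemma jinv_limit: "((\<lambda>\<tau>. jinv \<tau> * qexp \<tau>) \<longlongrightarrow> 1 / 256) (filtercomap Im at_top)"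
proof -
  let ?w = "\<lambda>\<tau>. exp (of_real pi * \<i> * \<tau>)"
  have "((\<lambda>\<tau>. modular_lambda \<tau> / ?w \<tau> * ?w \<tau>) \<longlongrightarrow> 16 * 0) (filtercomap Im at_top)"
    by (intro tendsto_intros modular_lambda_limit tendsto_nome)
  then have l: "(modular_lambda \<longlongrightarrow> 0) (filtercomap Im at_top)" by simp
  have "((\<lambda>\<tau>. ((modular_lambda \<tau>)\<^sup>2 - modular_lambda \<tau> + 1) ^ 3 /
      ((modular_lambda \<tau> / ?w \<tau>)\<^sup>2 * (1 - modular_lambda \<tau>)\<^sup>2)) \<longlongrightarrow>
      (0\<^sup>2 - 0 + 1) ^ 3 / (16\<^sup>2 * (1 - 0)\<^sup>2)) (filtercomap Im at_top)"
    by (intro tendsto_intros l modular_lambda_limit) auto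
  moreover have "((modular_lambda \<tau>)\<^sup>2 - modular_lambda \<tau> + 1) ^ 3 /
      ((modular_lambda \<tau> / ?w \<tau>)\<^sup>2 * (1 - modular_lambda \<tau>)\<^sup>2) = jinv \<tau> * qexp \<tau>" for \<tau>
  proof -
    have "qexp \<tau> = (?w \<tau>)\<^sup>2" by (simp add: qexp_def exp_double [symmetric] mult_ac)
    then show ?thesis by (simp add: jinv_def power_divide)
  qed
  ultimately show ?thesis by simp
qed

section \<open>Invariance under the modular group\<close>

lemma mobius_Im_pos:
  fixes a b c d :: int
  assumes "a * d - b * c = 1" and "Im \<tau> > 0"
  shows "Im ((of_int a * \<tau> + of_int b) / (of_int c * \<tau> + of_int d)) > 0"
proof -
  have "Im ((of_int a * \<tau> + of_int b) * cnj (of_int c * \<tau> + of_int d)) = of_int (a * d - b * c) * Im \<tau>"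
    by (simp add: algebra_simps)
  then show ?thesis using assms by (simp only: Im_complex_div_gt_0)
qed

lemma jinv_add_of_int:
  assumes "Im \<tau> > 0"
  shows "jinv (\<tau> + of_int n) = jinv \<tau>"
  using periodic_of_int[of "{\<tau>. Im \<tau> > 0}" jinv \<tau> n] jinv_add_1 assms by simp

text \<open>
  Translation and inversion generate the modular group: the Euclidean algorithm on the first column
  of the matrix reduces its lower left entry to 0.
\<close>

lemma jinv_SL2:
  fixes a b c d :: int
  assumes "a * d - b * c = 1" and "Im \<tau> > 0"
  shows "jinv ((of_int a * \<tau> + of_int b) / (of_int c * \<tau> + of_int d)) = jinv \<tau>"
  using assms(1)
proof (induction "nat \<bar>c\<bar>" arbitrary: a b c d rule: less_induct)
  case less
  show ?case
  proof (cases "c = 0")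
    case True
    then have "a * d = 1" using less.prems by simp
    then have "a = 1 \<and> d = 1 \<or> a = -1 \<and> d = -1" by (simp add: zmult_eq_1_iff)
    then have "(of_int a * \<tau> + of_int b) / (of_int c * \<tau> + of_int d) = \<tau> + of_int (a * b)"
      using True by auto
    then show ?thesis using jinv_add_of_int[OF assms(2), of "a * b"] by (simp only:)
  next
    case False
    define k where "k = a div c"
    define a' where "a' = a mod c"
    define b' where "b' = b - k * d"
    have a: "a = a' + k * c" by (simp add: a'_def k_def)
    have b: "b = b' + k * d" by (simp add: b'_def)
    have det: "a' * d - b' * c = 1" using less.prems by (simp add: a b algebra_simps)
    define \<sigma> where "\<sigma> = (of_int a' * \<tau> + of_int b') / (of_int c * \<tau> + of_int d)"
    have im: "Im \<sigma> > 0" unfolding \<sigma>_def by (rule mobius_Im_pos[OF det assms(2)])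
    have nz: "of_int c * \<tau> + of_int d \<noteq> 0" using im by (auto simp: \<sigma>_def)
    have "(of_int a * \<tau> + of_int b) / (of_int c * \<tau> + of_int d) = \<sigma> + of_int k"
    proof -
      have "of_int a * \<tau> + of_int b = (of_int a' * \<tau> + of_int b') + of_int k * (of_int c * \<tau> + of_int d)"
        by (simp add: a b algebra_simps)
      then show ?thesis using nz by (simp add: \<sigma>_def add_divide_distrib)
    qed
    then have "jinv ((of_int a * \<tau> + of_int b) / (of_int c * \<tau> + of_int d)) = jinv (- 1 / \<sigma>)"
      using jinv_add_of_int[OF im] jinv_inversion[OF im] by simp
    also have "- 1 / \<sigma> = (of_int (- c) * \<tau> + of_int (- d)) / (of_int a' * \<tau> + of_int b')"
      by (simp add: \<sigma>_def minus_divide_left)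
    also have "jinv \<dots> = jinv \<tau>"
    proof (rule less.hyps)
      show "nat \<bar>a'\<bar> < nat \<bar>c\<bar>" using False abs_mod_less[of c a] by (simp add: a'_def)
      show "- c * b' - - d * a' = 1" using det by (simp add: algebra_simps)
    qed
    finally show ?thesis .
  qed
qed

section \<open>Invariant functions are polynomials in the modular invariant\<close>

lemma tendsto_qexp: "(qexp \<longlongrightarrow> 0) (filtercomap Im at_top)"
proof -
  have "((\<lambda>\<tau>. (exp (of_real pi * \<i> * \<tau>))\<^sup>2) \<longlongrightarrow> 0\<^sup>2) (filtercomap Im at_top)"
    by (rule tendsto_power[OF tendsto_nome])
  moreover have "(exp (of_real pi * \<i> * \<tau>))\<^sup>2 = qexp \<tau>" for \<tau>
    by (simp add: qexp_def exp_double [symmetric] mult_ac)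
  ultimately show ?thesis by simp
qed

text \<open>
  As a function of \<open>q\<close>, \<open>h\<close> is holomorphic on the punctured unit disc and \<open>q h\<close> tends to 0 at the
  origin. So the singularity is removable, and \<open>h\<close> has a limit at the cusp.
\<close>

lemma periodic_convergent:
  assumes holo: "h holomorphic_on {\<tau>. Im \<tau> > 0}" and per: "\<And>\<tau>. Im \<tau> > 0 \<Longrightarrow> h (\<tau> + 1) = h \<tau>"
    and lim: "((\<lambda>\<tau>. h \<tau> * qexp \<tau>) \<longlongrightarrow> 0) (filtercomap Im at_top)"
  shows "\<exists>L. (h \<longlongrightarrow> L) (filtercomap Im at_top)"
proof -
  define T where "T w = Ln w / (2 * of_real pi * \<i>)" for w :: complex
  have T: "qexp (T w) = w" if "w \<noteq> 0" for w using qexp_Ln[OF that] by (simp add: T_def)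
  have normT: "norm w = exp (- (2 * pi * Im (T w)))" if "w \<noteq> 0" for w
    using norm_qexp[of "T w"] T[OF that] by simp
  have ImT: "Im (T w) > 0" if "w \<noteq> 0" "norm w < 1" for w
    using normT[OF that(1)] that(2) by (simp add: mult_less_0_iff zero_less_mult_iff)
  have image: "qexp ` {\<tau>. Im \<tau> > 0} = ball 0 1 - {0}"
  proof (intro equalityI subsetI)
    fix w :: complex assume "w \<in> ball 0 1 - {0}"
    then have "w = qexp (T w)" "T w \<in> {\<tau>. Im \<tau> > 0}" using T ImT by auto
    then show "w \<in> qexp ` {\<tau>. Im \<tau> > 0}" by (rule image_eqI)
  qed (auto simp: norm_qexp)
  have U: "\<tau> + 1 \<in> {\<tau>. Im \<tau> > 0} \<longleftrightarrow> \<tau> \<in> {\<tau>. Im \<tau> > 0}" for \<tau> by simp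
  have f: "h (\<tau> + 1) = h \<tau>" if "\<tau> \<in> {\<tau>. Im \<tau> > 0}" for \<tau> using per that by simp
  have "\<exists>g. g holomorphic_on ball 0 1 - {0} \<and> (\<forall>\<tau>. Im \<tau> > 0 \<longrightarrow> g (qexp \<tau>) = h \<tau>)"
    by (rule periodic_factor[OF open_halfspace_Im_gt holo U f]) (auto simp: image)
  then obtain g where g: "g holomorphic_on ball 0 1 - {0}" "\<And>\<tau>. Im \<tau> > 0 \<Longrightarrow> g (qexp \<tau>) = h \<tau>"
    by blast
  have "filterlim T (filtercomap Im at_top) (at 0)"
    unfolding filterlim_filtercomap_iff filterlim_at_top o_def
  proof
    fix Z :: real
    have "Z \<le> Im (T w)" if "w \<noteq> 0" "norm w < exp (- (2 * pi * Z))" for w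
      using normT[OF that(1)] that(2) by simp
    then show "\<forall>\<^sub>F w in at 0. Z \<le> Im (T w)"
      unfolding eventually_at by (intro exI[of _ "exp (- (2 * pi * Z))"]) auto
  qed
  then have "((\<lambda>w. h (T w) * qexp (T w)) \<longlongrightarrow> 0) (at 0)"
    by (rule filterlim_compose[OF lim])
  moreover have "\<forall>\<^sub>F w in at 0. h (T w) * qexp (T w) = (w - 0) * g w"
    unfolding eventually_at
  proof (intro exI[of _ 1] conjI ballI impI)
    fix w :: complex assume "w \<noteq> 0 \<and> dist w 0 < 1"
    then show "h (T w) * qexp (T w) = (w - 0) * g w"
      using T[of w] g(2)[of "T w"] ImT[of w] by simp
  qed simp
  ultimately have "((\<lambda>w. (w - 0) * g w) \<longlongrightarrow> 0) (at 0)"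
    by (rule Lim_transform_eventually)
  then have "\<exists>G. G holomorphic_on ball 0 1 \<and> (\<forall>w\<in>ball 0 1 - {0}. G w = g w)"
    using holomorphic_on_extend_lim[OF g(1)] by simp
  then obtain G where G: "G holomorphic_on ball 0 1" "\<And>w. w \<in> ball 0 1 - {0} \<Longrightarrow> G w = g w"
    by blast
  have "isCont G 0"
    using holomorphic_on_imp_continuous_on[OF G(1)] by (simp add: continuous_on_eq_continuous_at)
  then have "((\<lambda>\<tau>. G (qexp \<tau>)) \<longlongrightarrow> G 0) (filtercomap Im at_top)"
    by (rule isCont_tendsto_compose[OF _ tendsto_qexp])
  moreover have "\<forall>\<^sub>F \<tau> in filtercomap Im at_top. G (qexp \<tau>) = h \<tau>"
    using eventually_Im_ge[of 1]
  proof eventually_elim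
    case (elim \<tau>)
    then have "qexp \<tau> \<in> ball 0 1 - {0}" unfolding image [symmetric] by auto
    then show ?case using G(2) g(2) elim by simp
  qed
  ultimately have "(h \<longlongrightarrow> G 0) (filtercomap Im at_top)"
    by (rule Lim_transform_eventually)
  then show ?thesis by blast
qed

text \<open>
  Induction on the pole order at the cusp. Since \<open>jinv\<close> has a simple pole in \<open>q\<close>, subtracting a suitable
  multiple of \<open>jinv ^ n\<close> lowers the pole order; once there is no pole and no constant term, nothing
  is left.
\<close>

lemma invariant_imp_poly_jinv:
  assumes "f holomorphic_on {\<tau>. Im \<tau> > 0}"
    and "\<And>\<tau>. Im \<tau> > 0 \<Longrightarrow> f (\<tau> + 1) = f \<tau>" and "\<And>\<tau>. Im \<tau> > 0 \<Longrightarrow> f (- 1 / \<tau>) = f \<tau>"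
    and "((\<lambda>\<tau>. f \<tau> * qexp \<tau> ^ n) \<longlongrightarrow> 0) (filtercomap Im at_top)"
  shows "\<exists>P. \<forall>\<tau>. Im \<tau> > 0 \<longrightarrow> f \<tau> = poly P (jinv \<tau>)"
  using assms
proof (induction n arbitrary: f)
  case 0
  then have "f \<tau> = 0" if "Im \<tau> > 0" for \<tau>
    using that by (intro invariant_vanishing[of f]) simp_all
  then show ?case by (intro exI[of _ 0]) simp
next
  case (Suc n)
  have "\<exists>L. ((\<lambda>\<tau>. f \<tau> * qexp \<tau> ^ n) \<longlongrightarrow> L) (filtercomap Im at_top)"
  proof (rule periodic_convergent)
    show "(\<lambda>\<tau>. f \<tau> * qexp \<tau> ^ n) holomorphic_on {\<tau>. Im \<tau> > 0}"
      using Suc.prems(1) by (intro holomorphic_intros)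
  qed (use Suc.prems in \<open>simp_all add: qexp_add mult_ac\<close>)
  then obtain L where L: "((\<lambda>\<tau>. f \<tau> * qexp \<tau> ^ n) \<longlongrightarrow> L) (filtercomap Im at_top)" by blast
  \<comment> \<open>\<open>1 / 256\<close> is the residue of \<open>jinv\<close> with respect to \<open>q\<close>\<close>
  define c where "c = L * 256 ^ n"
  have "\<exists>P. \<forall>\<tau>. Im \<tau> > 0 \<longrightarrow> f \<tau> - c * jinv \<tau> ^ n = poly P (jinv \<tau>)"
  proof (rule Suc.IH)
    show "(\<lambda>\<tau>. f \<tau> - c * jinv \<tau> ^ n) holomorphic_on {\<tau>. Im \<tau> > 0}"
      using Suc.prems(1) by (intro holomorphic_intros jinv_holomorphic)
    show "f (\<tau> + 1) - c * jinv (\<tau> + 1) ^ n = f \<tau> - c * jinv \<tau> ^ n" if "Im \<tau> > 0" for \<tau>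
      using that by (simp only: Suc.prems(2) jinv_add_1)
    show "f (- 1 / \<tau>) - c * jinv (- 1 / \<tau>) ^ n = f \<tau> - c * jinv \<tau> ^ n" if "Im \<tau> > 0" for \<tau>
      using that by (simp only: Suc.prems(3) jinv_inversion)
    have "((\<lambda>\<tau>. f \<tau> * qexp \<tau> ^ n - c * (jinv \<tau> * qexp \<tau>) ^ n) \<longlongrightarrow> L - c * (1 / 256) ^ n) (filtercomap Im at_top)"
      by (intro tendsto_intros L jinv_limit)
    moreover have "f \<tau> * qexp \<tau> ^ n - c * (jinv \<tau> * qexp \<tau>) ^ n = (f \<tau> - c * jinv \<tau> ^ n) * qexp \<tau> ^ n" for \<tau>
      by (simp add: algebra_simps)
    moreover have "L - c * (1 / 256) ^ n = 0" by (simp add: c_def power_divide)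
    ultimately show "((\<lambda>\<tau>. (f \<tau> - c * jinv \<tau> ^ n) * qexp \<tau> ^ n) \<longlongrightarrow> 0) (filtercomap Im at_top)"
      by (simp only:)
  qed
  then obtain P where P: "\<And>\<tau>. Im \<tau> > 0 \<Longrightarrow> f \<tau> - c * jinv \<tau> ^ n = poly P (jinv \<tau>)" by blast
  have "f \<tau> = poly (P + smult c ([:0, 1:] ^ n)) (jinv \<tau>)" if "Im \<tau> > 0" for \<tau>
    using P[OF that] by (simp add: algebra_simps)
  then show ?case by blast
qed

text \<open>
  For a periodic function this growth condition means at most a pole at the cusp. In contrast to a
  pole order in \<open>q\<close>, it makes sense for functions of period \<open>p\<close> as well, and it is visibly stable under \<open>\<tau> \<mapsto> p \<tau>\<close> and
  \<open>\<tau> \<mapsto> (\<tau> + i) / p\<close>.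
\<close>

definition moderate :: "(complex \<Rightarrow> complex) \<Rightarrow> bool" where
  "moderate f \<longleftrightarrow> f holomorphic_on {\<tau>. Im \<tau> > 0} \<and>
     (\<exists>n::nat. \<forall>\<^sub>F \<tau> in filtercomap Im at_top. norm (f \<tau>) \<le> exp (real n * Im \<tau>))"

lemma moderate_const: "moderate (\<lambda>_. c)"
  unfolding moderate_def
proof (intro conjI exI)
  show "\<forall>\<^sub>F \<tau> in filtercomap Im at_top. norm c \<le> exp (real (nat \<lceil>norm c\<rceil>) * Im \<tau>)"
    using eventually_Im_ge[of 1]
  proof eventually_elim
    case (elim \<tau>)
    let ?n = "real (nat \<lceil>norm c\<rceil>)"
    have "norm c \<le> ?n" by linarith
    also have "?n = ?n * 1" by simp
    also have "\<dots> \<le> ?n * Im \<tau>" by (rule mult_left_mono[OF elim of_nat_0_le_iff])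
    also have "\<dots> \<le> exp (?n * Im \<tau>)" using exp_ge_add_one_self[of "?n * Im \<tau>"] by linarith
    finally show ?case .
  qed
qed simp

lemma moderate_add:
  assumes "moderate f" "moderate g"
  shows "moderate (\<lambda>\<tau>. f \<tau> + g \<tau>)"
proof -
  obtain m n where mn: "\<forall>\<^sub>F \<tau> in filtercomap Im at_top. norm (f \<tau>) \<le> exp (real m * Im \<tau>)"
    "\<forall>\<^sub>F \<tau> in filtercomap Im at_top. norm (g \<tau>) \<le> exp (real n * Im \<tau>)"
    using assms by (auto simp: moderate_def)
  have "\<forall>\<^sub>F \<tau> in filtercomap Im at_top. norm (f \<tau> + g \<tau>) \<le> exp (real (m + n + 1) * Im \<tau>)"
    using mn eventually_Im_ge[of 1]
  proof eventually_elim
    case (elim \<tau>)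
    have "norm (f \<tau> + g \<tau>) \<le> exp (real m * Im \<tau>) + exp (real n * Im \<tau>)"
      using elim norm_triangle_ineq[of "f \<tau>" "g \<tau>"] by linarith
    also have "\<dots> \<le> exp (real (m + n) * Im \<tau>) + exp (real (m + n) * Im \<tau>)"
      using elim by (intro add_mono) (auto intro!: mult_right_mono)
    also have "\<dots> = 2 * exp (real (m + n) * Im \<tau>)" by simp
    also have "\<dots> \<le> exp (Im \<tau>) * exp (real (m + n) * Im \<tau>)"
    proof (rule mult_right_mono)
      show "2 \<le> exp (Im \<tau>)" using elim exp_ge_add_one_self[of "Im \<tau>"] by linarith
    qed simp
    also have "\<dots> = exp (real (m + n + 1) * Im \<tau>)"
      by (simp add: exp_add [symmetric] algebra_simps)
    finally show ?case .
  qed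
  then show ?thesis using assms unfolding moderate_def by (blast intro: holomorphic_on_add)
qed

lemma moderate_mult:
  assumes "moderate f" "moderate g"
  shows "moderate (\<lambda>\<tau>. f \<tau> * g \<tau>)"
proof -
  obtain m n where mn: "\<forall>\<^sub>F \<tau> in filtercomap Im at_top. norm (f \<tau>) \<le> exp (real m * Im \<tau>)"
    "\<forall>\<^sub>F \<tau> in filtercomap Im at_top. norm (g \<tau>) \<le> exp (real n * Im \<tau>)"
    using assms by (auto simp: moderate_def)
  have "\<forall>\<^sub>F \<tau> in filtercomap Im at_top. norm (f \<tau> * g \<tau>) \<le> exp (real (m + n) * Im \<tau>)"
    using mn
  proof eventually_elim
    case (elim \<tau>)
    have "norm (f \<tau> * g \<tau>) \<le> exp (real m * Im \<tau>) * exp (real n * Im \<tau>)"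
      unfolding norm_mult using elim by (intro mult_mono) auto
    then show ?case by (simp add: exp_add [symmetric] algebra_simps)
  qed
  then show ?thesis using assms unfolding moderate_def by (blast intro: holomorphic_on_mult)
qed

lemma moderate_compose:
  assumes f: "moderate f" and g: "g holomorphic_on {\<tau>. Im \<tau> > 0}" "\<And>\<tau>. Im (g \<tau>) = k * Im \<tau>" and "k > 0"
  shows "moderate (\<lambda>\<tau>. f (g \<tau>))"
proof -
  obtain n N where nN: "\<And>\<tau>. Im \<tau> \<ge> N \<Longrightarrow> norm (f \<tau>) \<le> exp (real n * Im \<tau>)"
    using f by (auto simp: moderate_def eventually_filtercomap_at_top_linorder)
  have "\<forall>\<^sub>F \<tau> in filtercomap Im at_top. norm (f (g \<tau>)) \<le> exp (real (nat \<lceil>n * k\<rceil>) * Im \<tau>)"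
    using eventually_Im_ge[of 0] eventually_Im_ge[of "N / k"]
  proof eventually_elim
    case (elim \<tau>)
    then have "Im (g \<tau>) \<ge> N" using \<open>k > 0\<close> by (simp add: g(2) divide_le_eq mult.commute)
    then have "norm (f (g \<tau>)) \<le> exp ((real n * k) * Im \<tau>)" using nN[of "g \<tau>"] by (simp add: g(2) mult_ac)
    also have "\<dots> \<le> exp (real (nat \<lceil>n * k\<rceil>) * Im \<tau>)"
      using elim by (simp add: mult_right_mono real_nat_ceiling_ge)
    finally show ?case .
  qed
  moreover have "(f \<circ> g) holomorphic_on {\<tau>. Im \<tau> > 0}"
    using f g \<open>k > 0\<close> by (intro holomorphic_on_compose_gen[of g _ f "{\<tau>. Im \<tau> > 0}"]) (auto simp: moderate_def)
  ultimately show ?thesis unfolding moderate_def o_def by blast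
qed

lemma moderate_jinv: "moderate jinv"
proof -
  have "\<forall>\<^sub>F \<tau> in filtercomap Im at_top. norm (jinv \<tau> * qexp \<tau>) < 1"
    by (intro order_tendstoD(2)[OF tendsto_norm[OF jinv_limit]]) (simp add: norm_divide)
  \<comment> \<open>\<open>jinv\<close> grows like \<open>exp (2 \<pi> Im \<tau>)\<close>, and \<open>2 \<pi> < 8\<close>\<close>
  then have "\<forall>\<^sub>F \<tau> in filtercomap Im at_top. norm (jinv \<tau>) \<le> exp (real 8 * Im \<tau>)"
    using eventually_Im_ge[of 0]
  proof eventually_elim
    case (elim \<tau>)
    have "norm (jinv \<tau>) = norm (jinv \<tau> * qexp \<tau>) * exp (2 * pi * Im \<tau>)"
      by (simp add: norm_mult norm_qexp exp_minus)
    also have "\<dots> \<le> 1 * exp (2 * pi * Im \<tau>)" using elim by (intro mult_right_mono) auto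
    also have "\<dots> \<le> exp (real 8 * Im \<tau>)"
      using elim pi_less_4 by (simp add: mult_right_mono)
    finally show ?case .
  qed
  then show ?thesis unfolding moderate_def using jinv_holomorphic by blast
qed

lemma moderate_invariant_imp_poly_jinv:
  assumes f: "moderate f"
    and T: "\<And>\<tau>. Im \<tau> > 0 \<Longrightarrow> f (\<tau> + 1) = f \<tau>" and S: "\<And>\<tau>. Im \<tau> > 0 \<Longrightarrow> f (- 1 / \<tau>) = f \<tau>"
  shows "\<exists>P. \<forall>\<tau>. Im \<tau> > 0 \<longrightarrow> f \<tau> = poly P (jinv \<tau>)"
proof -
  obtain n where n: "\<forall>\<^sub>F \<tau> in filtercomap Im at_top. norm (f \<tau>) \<le> exp (real n * Im \<tau>)"
    using f by (auto simp: moderate_def)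
  have "((\<lambda>\<tau>. norm (qexp \<tau>)) \<longlongrightarrow> 0) (filtercomap Im at_top)"
    using tendsto_norm_zero[OF tendsto_qexp] .
  then have "((\<lambda>\<tau>. f \<tau> * qexp \<tau> ^ Suc n) \<longlongrightarrow> 0) (filtercomap Im at_top)"
  proof (rule Lim_null_comparison[rotated])
    show "\<forall>\<^sub>F \<tau> in filtercomap Im at_top. norm (f \<tau> * qexp \<tau> ^ Suc n) \<le> norm (qexp \<tau>)"
      using n eventually_Im_ge[of 0]
    proof eventually_elim
      case (elim \<tau>)
      have "norm (f \<tau> * qexp \<tau> ^ n) \<le> exp (real n * Im \<tau>) * exp (- (2 * pi * Im \<tau>)) ^ n"
        unfolding norm_mult norm_power norm_qexp using elim by (intro mult_right_mono) auto
      also have "\<dots> = exp (real n * (Im \<tau> * (1 - 2 * pi)))"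
        by (simp add: exp_of_nat_mult [symmetric] exp_add [symmetric] algebra_simps)
      also have "\<dots> \<le> 1"
        using elim pi_gt3 by (simp add: mult_nonneg_nonpos)
      finally have "norm (f \<tau> * qexp \<tau> ^ n) * norm (qexp \<tau>) \<le> 1 * norm (qexp \<tau>)"
        by (rule mult_right_mono) simp
      then show ?case by (simp add: norm_mult mult_ac)
    qed
  qed
  moreover have "f holomorphic_on {\<tau>. Im \<tau> > 0}" using f by (simp add: moderate_def)
  ultimately show ?thesis using T S invariant_imp_poly_jinv by blast
qed

lemma moderate_coeff_prod:
  assumes "finite A" "\<And>i. i \<in> A \<Longrightarrow> moderate (f i)"
  shows "moderate (\<lambda>\<tau>. coeff (\<Prod>i\<in>A. [:- f i \<tau>, 1:]) k)"
  using assms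
proof (induction A arbitrary: k rule: finite_induct)
  case empty
  then show ?case by (simp add: moderate_const)
next
  case (insert i A)
  have IH: "moderate (\<lambda>\<tau>. coeff (\<Prod>i\<in>A. [:- f i \<tau>, 1:]) k)" for k
    using insert by blast
  have "moderate (\<lambda>\<tau>. (-1) * f i \<tau> * coeff (\<Prod>i\<in>A. [:- f i \<tau>, 1:]) k)"
    using insert.prems by (intro moderate_mult moderate_const IH) simp
  moreover have "moderate (\<lambda>\<tau>. case k of 0 \<Rightarrow> 0 | Suc j \<Rightarrow> coeff (\<Prod>i\<in>A. [:- f i \<tau>, 1:]) j)"
    by (cases k) (simp_all add: moderate_const IH)
  ultimately have "moderate (\<lambda>\<tau>. (-1) * f i \<tau> * coeff (\<Prod>i\<in>A. [:- f i \<tau>, 1:]) k +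
      (case k of 0 \<Rightarrow> 0 | Suc j \<Rightarrow> coeff (\<Prod>i\<in>A. [:- f i \<tau>, 1:]) j))"
    by (rule moderate_add)
  then show ?case using insert.hyps by (simp add: coeff_pCons)
qed

section \<open>The modular equation\<close>

text \<open>
  The functions \<open>\<tau> \<mapsto> jinv (A \<tau>)\<close>, where \<open>A\<close> runs over representatives of the integer matrices of
  prime determinant \<open>p\<close> modulo left multiplication by the modular group; the index \<open>p\<close> stands for
  \<open>\<tau> \<mapsto> p \<tau>\<close>.
\<close>

definition hecke_conj :: "nat \<Rightarrow> nat \<Rightarrow> complex \<Rightarrow> complex" where
  "hecke_conj p i \<tau> = (if i = p then jinv (of_nat p * \<tau>) else jinv ((\<tau> + of_nat i) / of_nat p))"

definition modular_poly :: "nat \<Rightarrow> complex \<Rightarrow> complex poly" where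
  "modular_poly p \<tau> = (\<Prod>i\<le>p. [:- hecke_conj p i \<tau>, 1:])"

lemma modular_poly_eq:
  "modular_poly p \<tau> = (\<Prod>i<p. [:- jinv ((\<tau> + of_nat i) / of_nat p), 1:]) * [:- jinv (of_nat p * \<tau>), 1:]"
  unfolding modular_poly_def lessThan_Suc_atMost [symmetric] prod.lessThan_Suc
  by (intro arg_cong2[of _ _ _ _ "(*)"] prod.cong) (auto simp: hecke_conj_def)

lemma moderate_hecke_conj:
  assumes "p > 0"
  shows "moderate (hecke_conj p i)"
proof (cases "i = p")
  case True
  then have "hecke_conj p i = (\<lambda>\<tau>. jinv (of_nat p * \<tau>))"
    by (simp add: hecke_conj_def fun_eq_iff)
  moreover have "moderate (\<lambda>\<tau>. jinv (of_nat p * \<tau>))"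
    by (rule moderate_compose[OF moderate_jinv, of _ "real p"]) (use assms in \<open>auto intro!: holomorphic_intros\<close>)
  ultimately show ?thesis by simp
next
  case False
  then have "hecke_conj p i = (\<lambda>\<tau>. jinv ((\<tau> + of_nat i) / of_nat p))"
    by (simp add: hecke_conj_def fun_eq_iff)
  moreover have "moderate (\<lambda>\<tau>. jinv ((\<tau> + of_nat i) / of_nat p))"
    by (rule moderate_compose[OF moderate_jinv, of _ "1 / real p"])
       (use assms in \<open>auto intro!: holomorphic_intros simp: Im_divide_of_nat\<close>)
  ultimately show ?thesis by simp
qed

text \<open>
  Translation permutes the conjugates of index below \<open>p\<close> cyclically and fixes the remaining one. In
  the proof the cyclic shift is obtained from the product over all indices up to \<open>p\<close> by cancelling the
  factors of index \<open>0\<close> and \<open>p\<close>, which are equal.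
\<close>

lemma modular_poly_add_1:
  assumes "p > 0" "Im \<tau> > 0"
  shows "modular_poly p (\<tau> + 1) = modular_poly p \<tau>"
proof -
  define F where "F i = [:- jinv ((\<tau> + of_nat i) / of_nat p), 1:]" for i
  have im: "Im (\<tau> / of_nat p) > 0" "Im (of_nat p * \<tau>) > 0"
    using assms by (simp_all add: Im_divide_of_nat)
  have "(\<Prod>i<p. [:- jinv ((\<tau> + 1 + of_nat i) / of_nat p), 1:]) = (\<Prod>i<p. F (Suc i))"
    by (simp add: F_def add_ac)
  moreover have "F 0 * (\<Prod>i<p. F (Suc i)) = (\<Prod>i<p. F i) * F p"
    unfolding prod.lessThan_Suc_shift [symmetric] prod.lessThan_Suc ..
  moreover have "F p = F 0"
  proof -
    have "(\<tau> + of_nat p) / of_nat p = \<tau> / of_nat p + 1" using assms by (simp add: add_divide_distrib)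
    then show ?thesis using jinv_add_1[OF im(1)] by (simp add: F_def)
  qed
  moreover have "F 0 \<noteq> 0" by (simp add: F_def)
  ultimately have "(\<Prod>i<p. [:- jinv ((\<tau> + 1 + of_nat i) / of_nat p), 1:]) = (\<Prod>i<p. F i)"
    by (simp add: mult.commute)
  moreover have "jinv (of_nat p * (\<tau> + 1)) = jinv (of_nat p * \<tau>)"
    using jinv_add_of_int[OF im(2), of "int p"] by (simp add: ring_distribs)
  ultimately show ?thesis by (simp only: modular_poly_eq F_def)
qed

text \<open>
  With \<open>i j + 1 = p m\<close>, the matrix with rows \<open>(i, -m)\<close> and \<open>(p, -j)\<close> has determinant 1 and takes
  \<open>(\<tau> + j) / p\<close> to \<open>(-1/\<tau> + i) / p\<close>.
\<close>

lemma jinv_inversion_translate: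
  assumes "p > 0" "Im \<tau> > 0" "p dvd i * j + 1"
  shows "jinv ((- 1 / \<tau> + of_nat i) / of_nat p) = jinv ((\<tau> + of_nat j) / of_nat p)"
proof -
  have [simp]: "\<tau> \<noteq> 0" using assms by force
  obtain m where m: "i * j + 1 = p * m" using assms(3) by (elim dvdE)
  define \<sigma> where "\<sigma> = (\<tau> + of_nat j) / of_nat p"
  have im: "Im \<sigma> > 0" using assms by (simp add: \<sigma>_def Im_divide_of_nat)
  have det: "int i * (- int j) - (- int m) * int p = 1"
    using m by (simp add: algebra_simps flip: of_nat_mult of_nat_add) 
  have "of_int (int i) * \<sigma> + of_int (- int m) = (of_nat i * \<tau> - 1) / of_nat p"
  proof -
    have "of_nat i * of_nat j + 1 = (of_nat p * of_nat m :: complex)"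
      using m by (metis of_nat_1 of_nat_add of_nat_mult)
    then have "of_nat i * of_nat j - of_nat p * of_nat m = (- 1 :: complex)"
      by (simp add: algebra_simps)
    moreover have "of_int (int i) * \<sigma> + of_int (- int m) =
        (of_nat i * \<tau> + (of_nat i * of_nat j - of_nat p * of_nat m)) / of_nat p"
      using assms(1) by (simp add: \<sigma>_def field_simps)
    ultimately show ?thesis by simp
  qed
  moreover have "of_int (int p) * \<sigma> + of_int (- int j) = \<tau>"
    using assms(1) by (simp add: \<sigma>_def)
  ultimately have "jinv ((of_nat i * \<tau> - 1) / of_nat p / \<tau>) = jinv \<sigma>"
    using jinv_SL2[OF det im] by simp
  moreover have "(- 1 / \<tau> + of_nat i) / of_nat p = (of_nat i * \<tau> - 1) / of_nat p / \<tau>"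
    using assms(1) by (simp add: field_simps)
  ultimately show ?thesis by (simp only: \<sigma>_def)
qed

lemma negative_inverse_permutation:
  assumes "prime (p :: nat)"
  obtains \<sigma> where "bij_betw \<sigma> {1..<p} {1..<p}" "\<And>i. i \<in> {1..<p} \<Longrightarrow> p dvd i * \<sigma> i + 1"
proof -
  have "\<exists>j\<in>{1..<p}. p dvd i * j + 1" if i: "i \<in> {1..<p}" for i
  proof -
    have "coprime i p"
      using i assms by (metis atLeastLessThan_iff coprime_commute prime_imp_coprime nat_dvd_not_less
          less_le_trans zero_less_one)
    then obtain x where x: "[i * x = 1] (mod p)"
      using cong_solve_coprime_nat by fastforce
    \<comment> \<open>\<open>p - 1\<close> represents \<open>-1\<close> among the natural numbers\<close>
    define j where "j = (p - 1) * x mod p"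
    have "[i * j = (p - 1) * (i * x)] (mod p)"
      by (simp add: j_def cong_def mod_mult_right_eq mult_ac)
    also have "[(p - 1) * (i * x) = (p - 1) * 1] (mod p)"
      using x by (rule cong_scalar_left)
    finally have "[i * j + 1 = (p - 1) * 1 + 1] (mod p)"
      by (rule cong_add[OF _ cong_refl])
    moreover have "(p - 1) * 1 + 1 = p" using prime_gt_0_nat[OF assms] by simp
    ultimately have dvd: "p dvd i * j + 1"
      by (simp add: cong_def mod_eq_0_iff_dvd)
    then have "j \<noteq> 0" using assms by (metis add_0 mult_0_right not_prime_unit)
    moreover have "j < p" using prime_gt_0_nat[OF assms] by (simp add: j_def)
    ultimately show ?thesis using dvd by auto
  qed
  then have "\<exists>\<sigma>. \<forall>i\<in>{1..<p}. \<sigma> i \<in> {1..<p} \<and> p dvd i * \<sigma> i + 1"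
    by (intro bchoice) blast
  then obtain \<sigma> where \<sigma>: "\<And>i. i \<in> {1..<p} \<Longrightarrow> \<sigma> i \<in> {1..<p}" "\<And>i. i \<in> {1..<p} \<Longrightarrow> p dvd i * \<sigma> i + 1"
    by blast
  have "inj_on \<sigma> {1..<p}"
  proof (rule linorder_inj_onI')
    fix i j assume ij: "i \<in> {1..<p}" "j \<in> {1..<p}" "i < j"
    show "\<sigma> i \<noteq> \<sigma> j"
    proof
      assume eq: "\<sigma> i = \<sigma> j"
      have "p dvd (j * \<sigma> i + 1) - (i * \<sigma> i + 1)"
        using \<sigma>(2)[OF ij(1)] \<sigma>(2)[OF ij(2)] unfolding eq by (rule dvd_diff_nat[rotated])
      then have "p dvd (j - i) * \<sigma> i" by (simp add: diff_mult_distrib)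
      then have "p dvd j - i \<or> p dvd \<sigma> i" using assms by (simp add: prime_dvd_mult_iff)
      moreover have "\<not> p dvd j - i" using ij by (intro nat_dvd_not_less) auto
      moreover have "\<not> p dvd \<sigma> i" using \<sigma>(1)[OF ij(1)] by (intro nat_dvd_not_less) auto
      ultimately show False by blast
    qed
  qed
  moreover have "\<sigma> ` {1..<p} = {1..<p}"
    using \<sigma>(1) calculation by (intro endo_inj_surj) auto
  ultimately show ?thesis using \<sigma>(2) that by (auto simp: bij_betw_def)
qed

text \<open>
  Inversion exchanges the conjugates of index \<open>0\<close> and \<open>p\<close> and permutes the others by taking negative
  inverses modulo \<open>p\<close>.
\<close>

lemma modular_poly_inversion:
  assumes "prime p" "Im \<tau> > 0"
  shows "modular_poly p (- 1 / \<tau>) = modular_poly p \<tau>"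
proof -
  have p: "p > 0" using assms(1) prime_gt_0_nat by blast
  have im: "Im (\<tau> / of_nat p) > 0" "Im (of_nat p * \<tau>) > 0"
    using assms(2) p by (simp_all add: Im_divide_of_nat)
  obtain \<sigma> where \<sigma>: "bij_betw \<sigma> {1..<p} {1..<p}" "\<And>i. i \<in> {1..<p} \<Longrightarrow> p dvd i * \<sigma> i + 1"
    using negative_inverse_permutation[OF assms(1)] by blast
  have split: "(\<Prod>i<p. G i) = G 0 * (\<Prod>i\<in>{1..<p}. G i)" for G :: "nat \<Rightarrow> complex poly"
    using p by (simp add: lessThan_atLeast0 prod.atLeast_Suc_lessThan)
  have "(\<Prod>i\<in>{1..<p}. [:- jinv ((- 1 / \<tau> + of_nat i) / of_nat p), 1:]) =
      (\<Prod>i\<in>{1..<p}. [:- jinv ((\<tau> + of_nat (\<sigma> i)) / of_nat p), 1:])"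
    using jinv_inversion_translate[OF p assms(2) \<sigma>(2)] by (intro prod.cong refl) simp
  also have "\<dots> = (\<Prod>i\<in>{1..<p}. [:- jinv ((\<tau> + of_nat i) / of_nat p), 1:])"
    using \<sigma>(1) by (rule prod.reindex_bij_betw)
  finally have mid: "(\<Prod>i\<in>{1..<p}. [:- jinv ((- 1 / \<tau> + of_nat i) / of_nat p), 1:]) =
      (\<Prod>i\<in>{1..<p}. [:- jinv ((\<tau> + of_nat i) / of_nat p), 1:])" .
  have "jinv (of_nat p * (- 1 / \<tau>)) = jinv ((\<tau> + of_nat 0) / of_nat p)"
    using jinv_inversion[OF im(1)] by simp
  moreover have "jinv ((- 1 / \<tau> + of_nat 0) / of_nat p) = jinv (of_nat p * \<tau>)"
    using jinv_inversion[OF im(2)] by (simp add: mult.commute)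
  ultimately show ?thesis
    unfolding modular_poly_eq split mid by (simp only: mult_ac)
qed

lemma modular_poly_coeffs:
  assumes "prime p"
  shows "\<exists>P. \<forall>\<tau>. Im \<tau> > 0 \<longrightarrow> coeff (modular_poly p \<tau>) k = poly P (jinv \<tau>)"
proof (rule moderate_invariant_imp_poly_jinv)
  have p: "p > 0" using assms prime_gt_0_nat by blast
  show "moderate (\<lambda>\<tau>. coeff (modular_poly p \<tau>) k)"
    unfolding modular_poly_def by (intro moderate_coeff_prod moderate_hecke_conj p) simp
  show "coeff (modular_poly p (\<tau> + 1)) k = coeff (modular_poly p \<tau>) k" if "Im \<tau> > 0" for \<tau>
    using modular_poly_add_1[OF p that] by simp
  show "coeff (modular_poly p (- 1 / \<tau>)) k = coeff (modular_poly p \<tau>) k" if "Im \<tau> > 0" for \<tau>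
    using modular_poly_inversion[OF assms that] by simp
qed

lemma degree_modular_poly: "degree (modular_poly p \<tau>) = Suc p"
  unfolding modular_poly_def by (subst degree_prod_sum_eq) auto

lemma lead_coeff_modular_poly: "coeff (modular_poly p \<tau>) (Suc p) = 1"
proof -
  have "lead_coeff (modular_poly p \<tau>) = 1"
    unfolding modular_poly_def lead_coeff_prod by simp
  then show ?thesis by (simp add: degree_modular_poly)
qed

lemma poly_modular_poly: "poly (modular_poly p \<tau>) (jinv (of_nat p * \<tau>)) = 0"
  by (simp add: modular_poly_eq)

section \<open>The relation between \<open>\<lambda>(\<tau>)\<close> and \<open>\<lambda>(p \<tau>)\<close>\<close>

lemma poly2_add: "poly2 (P + Q) x y = poly2 P x y + poly2 Q x y"
  and poly2_mult: "poly2 (P * Q) x y = poly2 P x y * poly2 Q x y"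
  and poly2_const: "poly2 [:H:] x y = poly H x"
  and poly2_0: "poly2 0 x y = 0"
  by (simp_all add: poly2_def)

lemma poly2_sum: "poly2 (\<Sum>i\<in>A. P i) x y = (\<Sum>i\<in>A. poly2 (P i) x y)"
  by (simp add: poly2_def poly_sum)

lemma poly2_lift: "poly2 (map_poly (\<lambda>c. [:c:]) R) x y = poly R y"
  by (induction R) (simp_all add: poly2_def map_poly_pCons)

text \<open>
  Homogenization of \<open>C\<close>, with one exponent \<open>M\<close> that can be shared by several polynomials.
\<close>

lemma clear_denominators:
  fixes C N D :: "complex poly"
  assumes "degree C \<le> M"
  shows "\<exists>H. \<forall>x. poly D x \<noteq> 0 \<longrightarrow> poly D x ^ M * poly C (poly N x / poly D x) = poly H x"
proof (intro exI allI impI)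
  fix x assume nz: "poly D x \<noteq> 0"
  have "poly C (poly N x / poly D x) = (\<Sum>i\<le>M. coeff C i * (poly N x / poly D x) ^ i)"
    unfolding poly_altdef using assms
    by (intro sum.mono_neutral_left) (auto simp: coeff_eq_0)
  then have "poly D x ^ M * poly C (poly N x / poly D x) =
      (\<Sum>i\<le>M. poly D x ^ M * (coeff C i * (poly N x / poly D x) ^ i))"
    by (simp add: sum_distrib_left)
  also have "\<dots> = (\<Sum>i\<le>M. coeff C i * (poly N x ^ i * poly D x ^ (M - i)))"
  proof (intro sum.cong refl)
    fix i assume "i \<in> {..M}"
    then have "poly D x ^ M = poly D x ^ i * poly D x ^ (M - i)"
      by (simp flip: power_add)
    then show "poly D x ^ M * (coeff C i * (poly N x / poly D x) ^ i) =
        coeff C i * (poly N x ^ i * poly D x ^ (M - i))"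
      using nz by (simp add: power_divide)
  qed
  also have "\<dots> = poly (\<Sum>i\<le>M. smult (coeff C i) (N ^ i * D ^ (M - i))) x"
    by (simp add: poly_sum)
  finally show "poly D x ^ M * poly C (poly N x / poly D x) =
      poly (\<Sum>i\<le>M. smult (coeff C i) (N ^ i * D ^ (M - i))) x" .
qed

text \<open>
  Substituting the expression of \<open>jinv\<close> as a quotient \<open>N / D\<close> of polynomials in \<open>\<lambda>\<close> into the modular
  equation and clearing denominators gives \<open>P\<close>. It is not zero since \<open>D 0 = 0\<close> and \<open>N 0 = 1\<close>: setting
  \<open>Y = 0\<close> leaves only the contribution of the leading term, a power of \<open>D\<close>.
\<close>

theorem theorem3p1:
  fixes p :: nat
  assumes "prime p" and "odd p"
  shows "\<exists>P :: complex poly poly. P \<noteq> 0 \<and>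
           (\<forall>\<tau>. Im \<tau> > 0 \<longrightarrow>
              poly2 P (modular_lambda \<tau>) (modular_lambda (of_nat p * \<tau>)) = 0)"
proof -
  define N :: "complex poly" where "N = [:1, -1, 1:] ^ 3"
  define D :: "complex poly" where "D = [:0, 1:] ^ 2 * [:1, -1:] ^ 2"
  have D: "poly D (modular_lambda \<tau>) \<noteq> 0" if "Im \<tau> > 0" for \<tau>
    using modular_lambda_ne[OF that] by (simp add: D_def)
  have j: "jinv \<tau> = poly N (modular_lambda \<tau>) / poly D (modular_lambda \<tau>)" for \<tau>
    by (simp add: jinv_def N_def D_def power2_eq_square algebra_simps)
  obtain C where C: "\<And>k \<tau>. Im \<tau> > 0 \<Longrightarrow> coeff (modular_poly p \<tau>) k = poly (C k) (jinv \<tau>)"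
    using modular_poly_coeffs[OF assms(1)] by metis
  define M where "M = (\<Sum>k\<le>p. degree (C k))"
  have "\<exists>H. \<forall>x. poly D x \<noteq> 0 \<longrightarrow> poly D x ^ M * poly (C k) (poly N x / poly D x) = poly H x" if "k \<le> p" for k
    using that by (intro clear_denominators) (auto simp: M_def intro: member_le_sum)
  then obtain H where H: "\<And>k x. k \<le> p \<Longrightarrow> poly D x \<noteq> 0 \<Longrightarrow>
      poly D x ^ M * poly (C k) (poly N x / poly D x) = poly (H k) x"
    by metis
  define L where "L = map_poly (\<lambda>c :: complex. [:c:])"
  define P where "P = [:D ^ M:] * L (N ^ Suc p) + (\<Sum>k\<le>p. [:H k:] * L (N ^ k * D ^ (Suc p - k)))"
  have P: "poly2 P x y = poly D x ^ M * poly N y ^ Suc p +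
      (\<Sum>k\<le>p. poly (H k) x * (poly N y ^ k * poly D y ^ (Suc p - k)))" for x y
    by (simp only: P_def L_def poly2_add poly2_mult poly2_const poly2_sum poly2_lift poly_power poly_mult)
  have "P \<noteq> 0"
  proof
    assume "P = 0"
    then have "poly2 P 2 0 = 0" by (simp add: poly2_0)
    moreover have "poly D 0 = 0" "poly N 0 = 1" "poly D 2 = 4" by (simp_all add: N_def D_def)
    moreover have "(\<Sum>k\<le>p. poly (H k) 2 * 0 ^ (Suc p - k)) = 0"
      by (intro sum.neutral ballI) (simp add: Suc_diff_le)
    ultimately show False by (simp add: P)
  qed
  moreover have "poly2 P (modular_lambda \<tau>) (modular_lambda (of_nat p * \<tau>)) = 0" if im: "Im \<tau> > 0" for \<tau>
  proof -
    define x where "x = modular_lambda \<tau>"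
    define y where "y = modular_lambda (of_nat p * \<tau>)"
    have Dx: "poly D x \<noteq> 0" using D[OF im] by (simp add: x_def)
    have Dy: "poly D y \<noteq> 0"
      using D[of "of_nat p * \<tau>"] im prime_gt_0_nat[OF assms(1)] by (simp add: y_def)
    have top: "poly D y ^ Suc p * jinv (of_nat p * \<tau>) ^ Suc p = poly N y ^ Suc p"
      using Dy by (simp only: j y_def [symmetric] power_divide) simp
    have mid: "poly D y ^ Suc p * jinv (of_nat p * \<tau>) ^ k = poly N y ^ k * poly D y ^ (Suc p - k)"
      if "k \<le> p" for k
    proof -
      have "poly D y ^ Suc p = poly D y ^ k * poly D y ^ (Suc p - k)"
        using that by (simp flip: power_add)
      then show ?thesis using Dy by (simp add: j y_def [symmetric] power_divide)
    qed
    have "0 = poly (modular_poly p \<tau>) (jinv (of_nat p * \<tau>))" by (simp add: poly_modular_poly)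
    also have "\<dots> = (\<Sum>k\<le>p. poly (C k) (jinv \<tau>) * jinv (of_nat p * \<tau>) ^ k) + jinv (of_nat p * \<tau>) ^ Suc p"
      unfolding poly_altdef[of "modular_poly p \<tau>"] degree_modular_poly sum.atMost_Suc lead_coeff_modular_poly
      by (simp add: C[OF im])
    finally have "0 = poly D x ^ M * poly D y ^ Suc p *
        ((\<Sum>k\<le>p. poly (C k) (jinv \<tau>) * jinv (of_nat p * \<tau>) ^ k) + jinv (of_nat p * \<tau>) ^ Suc p)"
      by simp
    also have "\<dots> = poly D x ^ M * (poly D y ^ Suc p * jinv (of_nat p * \<tau>) ^ Suc p) +
        (\<Sum>k\<le>p. (poly D x ^ M * poly (C k) (jinv \<tau>)) * (poly D y ^ Suc p * jinv (of_nat p * \<tau>) ^ k))"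
      by (simp only: distrib_left sum_distrib_left mult_ac add.commute)
    also have "\<dots> = poly2 P x y"
    proof -
      have "(\<Sum>k\<le>p. (poly D x ^ M * poly (C k) (jinv \<tau>)) * (poly D y ^ Suc p * jinv (of_nat p * \<tau>) ^ k)) =
          (\<Sum>k\<le>p. poly (H k) x * (poly N y ^ k * poly D y ^ (Suc p - k)))"
        using H[OF _ Dx] mid by (intro sum.cong refl) (simp add: j[of \<tau>] x_def [symmetric])
      then show ?thesis by (simp only: P top)
    qed
    finally show ?thesis by (simp add: x_def y_def)
  qed
  ultimately show ?thesis by blast
qed

end
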